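(* Let $\mu\in\mathcal C$ be a nonzero nilpotent bracket, and let $\mu(t)$ be the solution of the bracket flow $\dot\mu(t)=-\pi(P_{\mu(t)})\mu(t)$, $\mu(0)=\mu$. Then $\mu(t)$ is defined for all $t\ge0$, and there is a constant $C>0$ such that for all $t>0$, $$\big(Ct+\|\mu\|^{-2}\big)^{-1}\le\|\mu(t)\|^2\le Ct^{-1}.$$ In particular $\mu(t)\to0$ as $t\to\infty$.
   Context: Let $\mathfrak g$ be a real vector space of dimension $2n$ with complex structure $J$ and inner product $\langle\cdot,\cdot\rangle$ for which $J$ is orthogonal; let $e_1,\dots,e_{2n}$ be an orthonormal basis. A bracket is a skew-symmetric bilinear map $\nu:\mathfrak g\times\mathfrak g\to\mathfrak g$ (equivalently a linear map $\Lambda^2\mathfrak g\to\mathfrak g$); $\Lambda^2\mathfrak g$ carries the inner product with $\langle v_1\wedge v_2,w_1\wedge w_2\rangle=\det(\langle v_i,w_j\rangle)$, and $\|\nu\|^2=\sum_{i<j}\|\nu(e_i,e_j)\|^2$. $\mathcal C$ denotes the set of brackets satisfying the Jacobi identity and $\nu(J\cdot,\cdot)=J\nu(\cdot,\cdot)$ (complex Lie brackets). For $A\in\mathrm{End}(\mathfrak g)$, $\pi(A)\nu=A\nu(\cdot,\cdot)-\nu(A\cdot,\cdot)-\nu(\cdot,A\cdot)$. $P_\nu:=\nu\nu^*\in\mathrm{End}(\mathfrak g)$, i.e. $P_\nu v=\sum_{i<j}\langle v,\nu(e_i,e_j)\rangle\nu(e_i,e_j)$ (this is the endomorphism representing the $\mathrm{HCF}_+$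 tensor $\Theta$ of the left-invariant metric $\langle\cdot,\cdot\rangle$ on the complex Lie group with Lie algebra $(\mathfrak g,\nu)$). *)

theory Defs
  imports "HOL-Analysis.Analysis"
begin

text \<open>The space g is modelled by a Euclidean space type 'a (inner product \<bullet>,
  orthonormal basis Basis). A bracket is a skew-symmetric bilinear map.\<close>

type_synonym 'a bracket = "'a \<Rightarrow> 'a \<Rightarrow> 'a"

definition is_bracket :: "('a::euclidean_space) bracket \<Rightarrow> bool" where
  "is_bracket \<nu> \<longleftrightarrow> bilinear \<nu> \<and> (\<forall>x y. \<nu> x y = - \<nu> y x)"

definition complex_structure :: "('a::euclidean_space \<Rightarrow> 'a) \<Rightarrow> bool" where
  "complex_structure J \<longleftrightarrow> linear J \<and> (\<forall>x. J (J x) = - x)"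

definition complex_lie_brackets :: "('a::euclidean_space \<Rightarrow> 'a) \<Rightarrow> 'a bracket set" where
  "complex_lie_brackets J = {\<nu>. is_bracket \<nu>
      \<and> (\<forall>x y z. \<nu> x (\<nu> y z) + \<nu> y (\<nu> z x) + \<nu> z (\<nu> x y) = 0)
      \<and> (\<forall>x y. \<nu> (J x) y = J (\<nu> x y))}"

fun lcs :: "('a::euclidean_space) bracket \<Rightarrow> nat \<Rightarrow> 'a set" where
  "lcs \<nu> 0 = UNIV"
| "lcs \<nu> (Suc k) = span {\<nu> x y | x y. y \<in> lcs \<nu> k}"

definition nilpotent_bracket :: "('a::euclidean_space) bracket \<Rightarrow> bool" where
  "nilpotent_bracket \<nu> \<longleftrightarrow> (\<exists>k. lcs \<nu> k = {0})"

text \<open>Squared norm: sum over i<j of |nu(e_i,e_j)|^2, written as half of the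
  sum over all ordered pairs (nu(e,e)=0 by skew-symmetry).\<close>
definition bnorm2 :: "('a::euclidean_space) bracket \<Rightarrow> real" where
  "bnorm2 \<nu> = (\<Sum>i\<in>Basis. \<Sum>j\<in>Basis. (norm (\<nu> i j))\<^sup>2) / 2"

text \<open>P_nu v = sum over i<j of <v, nu(e_i,e_j)> nu(e_i,e_j).\<close>
definition Pmap :: "('a::euclidean_space) bracket \<Rightarrow> 'a \<Rightarrow> 'a" where
  "Pmap \<nu> v = (\<Sum>i\<in>Basis. \<Sum>j\<in>Basis. (v \<bullet> \<nu> i j) *\<^sub>R \<nu> i j) /\<^sub>R 2"

definition pi_act :: "('a::euclidean_space \<Rightarrow> 'a) \<Rightarrow> 'a bracket \<Rightarrow> 'a bracket" where
  "pi_act A \<nu> = (\<lambda>x y. A (\<nu> x y) - \<nu> (A x) y - \<nu> x (A y))"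

definition bracket_flow_solution :: "('a::euclidean_space) bracket \<Rightarrow> (real \<Rightarrow> 'a bracket) \<Rightarrow> bool" where
  "bracket_flow_solution \<mu>0 \<mu> \<longleftrightarrow> \<mu> 0 = \<mu>0 \<and>
     (\<forall>t\<ge>0. is_bracket (\<mu> t) \<and>
        (\<forall>x y. ((\<lambda>s. \<mu> s x y) has_vector_derivative
                  (- pi_act (Pmap (\<mu> t)) (\<mu> t) x y)) (at t within {0..})))"

end

theory Submission
  imports Defs "HOL-Computational_Algebra.Polynomial"
begin

text \<open>
  Along the flow \<open>\<mu>(t) = h \<cdot> \<mu>\<close> with \<open>h' = - P h\<close>, and the inverse metric
  \<open>H = h\<^sup>-\<^sup>1 h\<^sup>-\<^sup>T\<close> on the dual satisfies the quadratic equation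
  \<open>H'(x, y) = \<Sum> \<langle>x, \<mu>(e\<^sub>i, e\<^sub>j)\<rangle> \<langle>y, \<mu>(e\<^sub>i, e\<^sub>j)\<rangle>\<close>, the sum running over an \<open>H\<close>-orthonormal frame.
  For nilpotent \<open>\<mu>\<close> this equation is triangular with respect to the annihilators of the lower central
  series, so Picard iteration stops after finitely many steps and \<open>H\<close> is a polynomial in \<open>t\<close>.
  Hence \<open>H\<close> exists for all times, and \<open>h\<close> is recovered from it by a linear equation.

  Each \<open>H(x, x)\<close> is a nondecreasing polynomial whose degree is bounded independently of \<open>x\<close>,
  so \<open>t H'(x, x) \<le> C H(x, x)\<close> by Markov's inequality. Since \<open>2 P = h H' h\<^sup>T\<close>, this says
  \<open>2 P \<le> C / t\<close>, and the trace of \<open>P\<close> is the squared norm of \<open>\<mu>(t)\<close>. The lower bound integrates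
  the differential inequality \<open>f' \<ge> - 2 f\<^sup>2\<close> for \<open>f = \<parallel>\<mu>(t)\<parallel>\<^sup>2\<close>.
\<close>

section \<open>Linear differential equations\<close>

lemma linear_expand_Basis:
  fixes f :: "'a::euclidean_space \<Rightarrow> 'b::real_vector"
  assumes "linear f"
  shows "f x = (\<Sum>b\<in>Basis. (x \<bullet> b) *\<^sub>R f b)"
proof -
  have "f x = f (\<Sum>b\<in>Basis. (x \<bullet> b) *\<^sub>R b)"
    by (simp add: euclidean_representation)
  then show ?thesis
    by (simp add: linear_sum[OF assms] linear_scale[OF assms])
qed

lemma at_within_atLeast_eq_atLeastAtMost:
  fixes t T :: real
  assumes "0 \<le> t" "t < T"
  shows "at t within {0..} = at t within {0..T}"
  using assms by (intro at_within_nhd[where S = "{..<T}"]) auto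

lemma integral_has_vector_derivative_atLeast:
  fixes f :: "real \<Rightarrow> 'b::banach"
  assumes "continuous_on {0..} f" "0 \<le> t"
  shows "((\<lambda>u. integral {0..u} f) has_vector_derivative f t) (at t within {0..})"
proof -
  have "continuous_on {0..t+1} f"
    using assms(1) by (rule continuous_on_subset) auto
  then show ?thesis
    using integral_has_vector_derivative[of 0 "t+1" f t] assms(2)
    by (simp add: at_within_atLeast_eq_atLeastAtMost[of t "t+1"])
qed

lemma continuous_on_has_vector_derivative:
  fixes f :: "real \<Rightarrow> 'b::real_normed_vector"
  assumes "\<And>t. t \<in> S \<Longrightarrow> (f has_vector_derivative f' t) (at t within S)"
  shows "continuous_on S f"
  using assms by (meson continuous_on_eq_continuous_within has_vector_derivative_continuous)

lemma eq_initial_value: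
  fixes f :: "real \<Rightarrow> 'b::real_normed_vector"
  assumes "\<And>s. 0 \<le> s \<Longrightarrow> (f has_vector_derivative 0) (at s within {0..})" "0 \<le> t"
  shows "f t = f 0"
proof -
  obtain c where "\<And>s. s \<in> {0..} \<Longrightarrow> f s = c"
    using has_vector_derivative_zero_constant[of "{0..}" f] assms(1) by auto
  then show ?thesis using assms(2) by simp
qed

lemma nondecreasing_on_ray:
  fixes f :: "real \<Rightarrow> real"
  assumes "\<And>s. 0 \<le> s \<Longrightarrow> (f has_vector_derivative f' s) (at s within {0..})"
    and "\<And>s. a \<le> s \<Longrightarrow> s \<le> b \<Longrightarrow> 0 \<le> f' s" "0 \<le> a" "a \<le> b"
  shows "f a \<le> f b"
proof (cases "a = b")
  case False
  then have "a < b" using \<open>a \<le> b\<close> by simp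
  have "(f has_derivative (\<lambda>h. h *\<^sub>R f' s)) (at s within {a..b})" if "a \<le> s" "s \<le> b" for s
    using has_vector_derivative_within_subset[OF assms(1), of s "{a..b}"] that \<open>0 \<le> a\<close>
    by (auto simp: has_vector_derivative_def)
  from mvt_simple[OF \<open>a < b\<close> this] obtain s where "s \<in> {a<..<b}" "f b - f a = (b - a) *\<^sub>R f' s" by blast
  with assms(2)[of s] \<open>0 \<le> a\<close> have "0 \<le> f b - f a" by simp
  then show ?thesis by simp
qed simp

text \<open>In finite dimension pointwise continuity of the family suffices: expanding
  \<open>x t\<close> in the basis leaves only the finitely many curves \<open>A t b\<close>.\<close>

lemma continuous_on_linear_family:
  fixes A :: "real \<Rightarrow> 'a::euclidean_space \<Rightarrow> 'b::real_normed_vector"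
  assumes "\<And>t. t \<in> S \<Longrightarrow> linear (A t)" "\<And>x. continuous_on S (\<lambda>t. A t x)" "continuous_on S x"
  shows "continuous_on S (\<lambda>t. A t (x t))"
proof -
  have "continuous_on S (\<lambda>t. \<Sum>b\<in>Basis. (x t \<bullet> b) *\<^sub>R A t b)"
    by (intro continuous_intros assms)
  moreover have "A t (x t) = (\<Sum>b\<in>Basis. (x t \<bullet> b) *\<^sub>R A t b)" if "t \<in> S" for t
    using assms(1)[OF that] by (rule linear_expand_Basis)
  ultimately show ?thesis
    by (simp cong: continuous_on_cong)
qed

lemma linear_family_bounded:
  fixes A :: "real \<Rightarrow> 'a::euclidean_space \<Rightarrow> 'b::real_normed_vector"
  assumes "\<And>t. t \<in> S \<Longrightarrow> linear (A t)" "\<And>x. continuous_on S (\<lambda>t. A t x)" "compact S"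
  obtains L where "0 \<le> L" "\<And>t x. t \<in> S \<Longrightarrow> norm (A t x) \<le> L * norm x"
proof -
  have "\<exists>M. \<forall>t\<in>S. norm (A t b) \<le> M" for b
    using compact_imp_bounded[OF compact_continuous_image[OF assms(2)[of b] assms(3)]]
    by (auto simp: bounded_iff)
  then obtain M where M: "\<And>b t. t \<in> S \<Longrightarrow> norm (A t b) \<le> M b" by metis
  show ?thesis
  proof
    show "0 \<le> (\<Sum>b\<in>Basis. \<bar>M b\<bar>)" by (simp add: sum_nonneg)
    fix t x assume t: "t \<in> S"
    have "norm (A t x) = norm (\<Sum>b\<in>Basis. (x \<bullet> b) *\<^sub>R A t b)"
      by (metis linear_expand_Basis[OF assms(1)[OF t]])
    also have "\<dots> \<le> (\<Sum>b\<in>Basis. norm x * \<bar>M b\<bar>)"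
    proof (rule sum_norm_le)
      fix b :: 'a assume "b \<in> Basis"
      then show "norm ((x \<bullet> b) *\<^sub>R A t b) \<le> norm x * \<bar>M b\<bar>"
        using M[OF t, of b] by (auto intro!: mult_mono Basis_le_norm)
    qed
    finally show "norm (A t x) \<le> (\<Sum>b\<in>Basis. \<bar>M b\<bar>) * norm x"
      by (simp add: sum_distrib_left[symmetric] mult.commute)
  qed
qed

text \<open>Single terms of the Dyson series, not its partial sums; their sum solves
  \<open>x' = A x\<close> with \<open>x 0 = v\<close>.\<close>

fun dyson :: "(real \<Rightarrow> 'a \<Rightarrow> 'a) \<Rightarrow> 'a \<Rightarrow> nat \<Rightarrow> real \<Rightarrow> 'a::euclidean_space" where
  "dyson A v 0 = (\<lambda>t. v)"
| "dyson A v (Suc n) = (\<lambda>t. integral {0..t} (\<lambda>s. A s (dyson A v n s)))"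

text \<open>On \<open>{0..T}\<close> the factorials in the bounds of the iterated integrals make
  their series converge uniformly. The derivative of each term is \<open>A\<close> applied to the
  preceding term, so the differentiated series converges uniformly to \<open>A t (x t)\<close>, and
  the series may be differentiated term by term.\<close>

lemma linear_ode_solution_exists:
  fixes A :: "real \<Rightarrow> 'a::euclidean_space \<Rightarrow> 'a"
  assumes lin: "\<And>t. 0 \<le> t \<Longrightarrow> linear (A t)" and cont: "\<And>x. continuous_on {0..} (\<lambda>t. A t x)"
  obtains x where "x 0 = v" "\<And>t. 0 \<le> t \<Longrightarrow> (x has_vector_derivative A t (x t)) (at t within {0..})"
proof -
  let ?d = "dyson A v"
  have cont_d: "continuous_on {0..} (?d n)" for n
  proof (induction n)
    case (Suc n)
    have "continuous_on {0..} (\<lambda>t. A t (?d n t))"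
      using lin cont Suc by (rule_tac continuous_on_linear_family) auto
    from continuous_on_has_vector_derivative[OF integral_has_vector_derivative_atLeast[OF this]]
    show ?case by simp
  qed simp
  have cont_Ad: "continuous_on {0..} (\<lambda>t. A t (?d n t))" for n
    using lin cont cont_d by (rule_tac continuous_on_linear_family) auto
  define d' where "d' n t = (case n of 0 \<Rightarrow> 0 | Suc k \<Rightarrow> A t (?d k t))" for n t
  have der_d: "(?d n has_vector_derivative d' n t) (at t within {0..})" if "0 \<le> t" for n t
    using integral_has_vector_derivative_atLeast[OF cont_Ad that]
    by (cases n) (simp_all add: d'_def)
  define x where "x t = (\<Sum>n. ?d n t)" for t
  have deriv: "(x has_vector_derivative A t (x t)) (at t within {0..T})" if "t \<in> {0..T}" for t T
  proof -
    obtain L where L0: "0 \<le> L" and L: "\<And>t x. t \<in> {0..T} \<Longrightarrow> norm (A t x) \<le> L * norm x"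
      using linear_family_bounded[of "{0..T}" A] lin continuous_on_subset[OF cont, of "{0..T}"] by auto
    have bd: "norm (?d n t) \<le> norm v * (L * t) ^ n / fact n" if "t \<in> {0..T}" for n t
      using that
    proof (induction n arbitrary: t)
      case (Suc n)
      have "((\<lambda>s. L * (norm v * (L * s) ^ n / fact n)) has_integral
          norm v * (L * t) ^ Suc n / fact (Suc n) - norm v * (L * 0) ^ Suc n / fact (Suc n)) {0..t}"
      proof (rule fundamental_theorem_of_calculus)
        fix s assume "s \<in> {0..t}"
        show "((\<lambda>s. norm v * (L * s) ^ Suc n / fact (Suc n)) has_vector_derivative
            L * (norm v * (L * s) ^ n / fact n)) (at s within {0..t})"
          unfolding has_real_derivative_iff_has_vector_derivative[symmetric]
          by (rule derivative_eq_intros refl | simp)+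
      qed (use Suc in auto)
      then have I: "((\<lambda>s. L * (norm v * (L * s) ^ n / fact n)) has_integral
          norm v * (L * t) ^ Suc n / fact (Suc n)) {0..t}" by simp
      have "norm (?d (Suc n) t) \<le> integral {0..t} (\<lambda>s. L * (norm v * (L * s) ^ n / fact n))"
        unfolding dyson.simps
      proof (rule integral_norm_bound_integral)
        show "(\<lambda>s. A s (?d n s)) integrable_on {0..t}"
          by (rule integrable_continuous_real continuous_on_subset[OF cont_Ad])+ auto
        show "norm (A s (?d n s)) \<le> L * (norm v * (L * s) ^ n / fact n)" if "s \<in> {0..t}" for s
          using L[of s "?d n s"] mult_left_mono[OF Suc.IH[of s] L0] Suc.prems that by force
      qed (use I in blast)
      also have "\<dots> = norm v * (L * t) ^ Suc n / fact (Suc n)"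
        using I by (rule integral_unique)
      finally show ?case .
    qed simp
    have bdT: "norm (?d n t) \<le> norm v * ((L * T) ^ n / fact n)" if "t \<in> {0..T}" for n t
    proof -
      have "(L * t) ^ n \<le> (L * T) ^ n"
        using that L0 by (intro power_mono mult_left_mono) auto
      then show ?thesis
        using bd[OF that, of n] by (simp add: divide_right_mono mult_left_mono order_trans)
    qed
    have sm: "summable (\<lambda>n. norm v * ((L * T) ^ n / fact n))"
      using summable_exp[of "L * T"] by (intro summable_mult) (simp add: field_simps)
    have unif: "uniform_limit {0..T} (\<lambda>n t. \<Sum>i<n. ?d i t) x sequentially"
      unfolding x_def by (rule Weierstrass_m_test[OF bdT sm])
    have sums_x: "(\<lambda>n. ?d n t) sums x t" if "t \<in> {0..T}" for t
      unfolding x_def using summable_comparison_test'[OF sm bdT[OF that]] by (simp add: summable_sums)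
    have "\<exists>g. \<forall>t\<in>{0..T}. (\<lambda>n. ?d n t) sums g t \<and>
        (g has_derivative (\<lambda>h. h *\<^sub>R A t (x t))) (at t within {0..T})"
    proof (rule has_derivative_series[where x = t])
      show "(?d n has_derivative (\<lambda>h. h *\<^sub>R d' n s)) (at s within {0..T})" if "s \<in> {0..T}" for n s
        using has_vector_derivative_within_subset[OF der_d, of s "{0..T}" n] that
        by (auto simp: has_vector_derivative_def)
      fix e :: real assume "0 < e"
      \<comment> \<open>Dividing by \<open>L + 1\<close> rather than \<open>L\<close> covers the
        case \<open>L = 0\<close>.\<close>
      then have "0 < e / (L + 1)" using L0 by simp
      then have "\<forall>\<^sub>F n in sequentially. \<forall>s\<in>{0..T}. norm ((\<Sum>i<n. ?d i s) - x s) < e / (L + 1)"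
        using unif by (simp add: uniform_limit_iff dist_norm)
      then have "\<forall>\<^sub>F n in sequentially. \<forall>s\<in>{0..T}. norm ((\<Sum>i<n. d' i s) - A s (x s)) \<le> e"
      \<comment> \<open>Since \<open>d' 0 = 0\<close>, the first \<open>n + 1\<close> derivatives
        add up to \<open>A\<close> applied to the sum of the first \<open>n\<close> terms; hence the
        shift of the index.\<close>
      proof (subst eventually_sequentially_Suc[symmetric], eventually_elim)
        case (elim n)
        show ?case
        proof
          fix s assume s: "s \<in> {0..T}"
          interpret linear "A s" using lin s by simp
          have "(\<Sum>i<Suc n. d' i s) - A s (x s) = A s ((\<Sum>i<n. ?d i s) - x s)"
            by (simp add: sum.lessThan_Suc_shift d'_def sum diff del: sum.lessThan_Suc)
          also have "norm \<dots> \<le> L * norm ((\<Sum>i<n. ?d i s) - x s)" by (rule L[OF s])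
          also have "\<dots> \<le> L * (e / (L + 1))"
            using elim s L0 by (intro mult_left_mono) (auto intro: less_imp_le)
          also have "\<dots> \<le> e" using L0 \<open>0 < e\<close> by (simp add: field_simps)
          finally show "norm ((\<Sum>i<Suc n. d' i s) - A s (x s)) \<le> e" .
        qed
      qed
      then show "\<forall>\<^sub>F n in sequentially. \<forall>s\<in>{0..T}. \<forall>h.
          norm ((\<Sum>i<n. h *\<^sub>R d' i s) - h *\<^sub>R A s (x s)) \<le> e * norm h"
        by eventually_elim
          (auto simp: scaleR_sum_right[symmetric] scaleR_diff_right[symmetric] mult.commute[of e]
            intro!: mult_left_mono)
    qed (use that sums_x in auto)
    then obtain g where "\<forall>t\<in>{0..T}. (\<lambda>n. ?d n t) sums g t \<and>
        (g has_derivative (\<lambda>h. h *\<^sub>R A t (x t))) (at t within {0..T})" ..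
    then have g: "\<And>s. s \<in> {0..T} \<Longrightarrow> (\<lambda>n. ?d n s) sums g s"
      and "(g has_vector_derivative A t (x t)) (at t within {0..T})"
      using that by (auto simp: has_vector_derivative_def)
    moreover have "x s = g s" if "s \<in> {0..T}" for s
      using sums_x[OF that] g[OF that] by (rule sums_unique2)
    ultimately show ?thesis
      using that by (rule_tac has_vector_derivative_transform) auto
  qed
  show ?thesis
  proof
    have "?d n 0 = (if n = 0 then v else 0)" for n by (cases n) auto
    then show "x 0 = v" using sums_unique[OF sums_single[of 0 "\<lambda>_. v"]] by (simp add: x_def)
    \<comment> \<open>With \<open>T = t + 1\<close> the point \<open>t\<close> is not the right end
      of the interval, so derivatives within the interval and within the ray agree.\<close>
    show "(x has_vector_derivative A t (x t)) (at t within {0..})" if "0 \<le> t" for t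
      using deriv[of t "t+1"] that by (simp add: at_within_atLeast_eq_atLeastAtMost[of t "t+1"])
  qed
qed

text \<open>The solutions started at the basis vectors are the columns of the fundamental matrix.
  Extending them linearly makes \<open>K t\<close> linear by construction, without an appeal to
  uniqueness of solutions.\<close>

lemma linear_ode_flow_exists:
  fixes A :: "real \<Rightarrow> 'a::euclidean_space \<Rightarrow> 'a"
  assumes lin: "\<And>t. 0 \<le> t \<Longrightarrow> linear (A t)" and cont: "\<And>x. continuous_on {0..} (\<lambda>t. A t x)"
  obtains K where "\<And>t. linear (K t)" "\<And>x. K 0 x = x"
    "\<And>t x. 0 \<le> t \<Longrightarrow> ((\<lambda>s. K s x) has_vector_derivative A t (K t x)) (at t within {0..})"
proof -
  have "\<exists>x. x 0 = v \<and> (\<forall>t\<ge>0. (x has_vector_derivative A t (x t)) (at t within {0..}))" for v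
    using linear_ode_solution_exists[OF assms, of v] by metis
  then obtain X where X0: "\<And>v. X v 0 = v"
    and X: "\<And>v t. 0 \<le> t \<Longrightarrow> (X v has_vector_derivative A t (X v t)) (at t within {0..})"
    by metis
  define K where "K t v = (\<Sum>b\<in>Basis. (v \<bullet> b) *\<^sub>R X b t)" for t v
  show ?thesis
  proof
    show "linear (K t)" for t
      by (rule linearI) (simp_all add: K_def inner_add_left scaleR_add_left sum.distrib scaleR_sum_right)
    show "K 0 x = x" for x
      by (simp add: K_def X0 euclidean_representation)
    fix t :: real and x :: 'a assume t: "0 \<le> t"
    interpret linear "A t" using lin t by simp
    show "((\<lambda>s. K s x) has_vector_derivative A t (K t x)) (at t within {0..})"
      unfolding K_def sum scale using X[OF t]
      by (intro has_vector_derivative_sum) (auto intro!: derivative_eq_intros)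
  qed
qed

section \<open>Polynomials of bounded degree\<close>

lemma pderiv_sum: "pderiv (\<Sum>i\<in>I. f i) = (\<Sum>i\<in>I. pderiv (f i))"
  by (induction I rule: infinite_finite_induct) (simp_all add: pderiv_add)

lemma poly_antiderivative_exists:
  fixes p :: "real poly"
  obtains q where "pderiv q = p" "poly q 0 = 0" "degree q \<le> Suc (degree p)"
proof
  let ?q = "\<Sum>i\<le>degree p. monom (coeff p i / real (Suc i)) (Suc i)"
  have "pderiv ?q = (\<Sum>i\<le>degree p. monom (coeff p i) i)"
    by (simp add: pderiv_sum pderiv_monom)
  then show "pderiv ?q = p" by (simp add: poly_as_sum_of_monoms)
  show "poly ?q 0 = 0" by (simp add: poly_sum poly_monom)
  show "degree ?q \<le> Suc (degree p)"
    by (intro degree_sum_le) (auto intro: order_trans[OF degree_monom_le])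
qed

text \<open>Lagrange interpolation at \<open>d + 1\<close> nodes in \<open>[0, 1]\<close> writes \<open>p'(1)\<close> as a fixed linear combination of values of \<open>p\<close>.\<close>
lemma pderiv_at_1_bound:
  obtains C :: real where "0 \<le> C"
    "\<And>p M. degree p \<le> d \<Longrightarrow> (\<And>s. 0 \<le> s \<Longrightarrow> s \<le> 1 \<Longrightarrow> \<bar>poly p s\<bar> \<le> M) \<Longrightarrow> \<bar>poly (pderiv p) 1\<bar> \<le> C * M"
proof -
  define S where "S = (\<lambda>i. real i / real (Suc d)) ` {..d}"
  have "inj_on (\<lambda>i. real i / real (Suc d)) {..d}" by (auto simp: inj_on_def)
  then have S: "finite S" "card S = Suc d" "S \<subseteq> {0..1}"
    by (auto simp: S_def card_image)
  define l where "l s = (\<Prod>r\<in>S - {s}. smult (1 / (s - r)) [:- r, 1:])" for s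
  have degl: "degree (l s) \<le> d" if "s \<in> S" for s
  proof -
    have "degree (l s) \<le> (\<Sum>r\<in>S - {s}. degree (smult (1 / (s - r)) [:- r, 1:]))"
      unfolding l_def using degree_prod_sum_le[of "S - {s}" "\<lambda>r. smult (1 / (s - r)) [:- r, 1:]"] S(1) by (simp add: o_def)
    also have "\<dots> \<le> (\<Sum>r\<in>S - {s}. 1)" by (intro sum_mono) simp
    finally show ?thesis using S that by simp
  qed
  have l_node: "poly (l s) r = (if r = s then 1 else 0)" if "s \<in> S" "r \<in> S" for s r
  proof (cases "r = s")
    case True
    have "poly (l s) s = (\<Prod>r\<in>S - {s}. 1)"
      unfolding l_def poly_prod by (intro prod.cong) (auto simp: diff_divide_distrib[symmetric])
    then show ?thesis using True by simp
  next
    case False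
    then show ?thesis using that S(1) unfolding l_def poly_prod by (auto intro!: prod_zero bexI[of _ r])
  qed
  show ?thesis
  proof
    show "0 \<le> (\<Sum>s\<in>S. \<bar>poly (pderiv (l s)) 1\<bar>)" by (simp add: sum_nonneg)
    fix p :: "real poly" and M
    assume deg: "degree p \<le> d" and M: "\<And>s. 0 \<le> s \<Longrightarrow> s \<le> 1 \<Longrightarrow> \<bar>poly p s\<bar> \<le> M"
    have "p = (\<Sum>s\<in>S. smult (poly p s) (l s))"
    proof (rule poly_eqI_degree[where A = S])
      have "degree (\<Sum>s\<in>S. smult (poly p s) (l s)) \<le> d"
        using degl by (intro degree_sum_le S) (auto intro: order_trans[OF degree_smult_le])
      then show "degree (\<Sum>s\<in>S. smult (poly p s) (l s)) < card S" using S by simp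
      show "poly p r = poly (\<Sum>s\<in>S. smult (poly p s) (l s)) r" if "r \<in> S" for r
        using that S(1) by (simp add: poly_sum l_node if_distrib cong: if_cong)
    qed (use deg S in auto)
    from arg_cong[OF this, of pderiv]
    have "pderiv p = (\<Sum>s\<in>S. smult (poly p s) (pderiv (l s)))"
      by (simp add: pderiv_smult pderiv_sum)
    then have "\<bar>poly (pderiv p) 1\<bar> = \<bar>\<Sum>s\<in>S. poly p s * poly (pderiv (l s)) 1\<bar>"
      by (simp add: poly_sum)
    also have "\<dots> \<le> (\<Sum>s\<in>S. M * \<bar>poly (pderiv (l s)) 1\<bar>)"
      using S(3) M by (intro order_trans[OF sum_abs] sum_mono) (auto simp: abs_mult intro!: mult_right_mono)
    finally show "\<bar>poly (pderiv p) 1\<bar> \<le> (\<Sum>s\<in>S. \<bar>poly (pderiv (l s)) 1\<bar>) * M"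
      by (simp add: sum_distrib_left[symmetric] mult.commute)
  qed
qed

text \<open>Rescaling \<open>{0..t}\<close> to the unit interval multiplies the derivative at the
  right end by \<open>t\<close>, and \<open>poly p t\<close> bounds the polynomial in absolute value
  there. The constant depends on the degree bound alone.\<close>

lemma nondecreasing_poly_deriv_bound:
  obtains C :: real where "0 \<le> C"
    "\<And>p t. degree p \<le> d \<Longrightarrow> 0 < t \<Longrightarrow> (\<And>s. 0 \<le> s \<Longrightarrow> s \<le> t \<Longrightarrow> 0 \<le> poly p s \<and> poly p s \<le> poly p t)
      \<Longrightarrow> poly (pderiv p) t \<le> C / t * poly p t"
proof -
  obtain C :: real where C0: "0 \<le> C" and
    C: "\<And>p M. degree p \<le> d \<Longrightarrow> (\<And>s. 0 \<le> s \<Longrightarrow> s \<le> 1 \<Longrightarrow> \<bar>poly p s\<bar> \<le> M) \<Longrightarrow> \<bar>poly (pderiv p) 1\<bar> \<le> C * M"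
    using pderiv_at_1_bound by blast
  show ?thesis
  proof
    fix p :: "real poly" and t :: real
    assume deg: "degree p \<le> d" and t: "0 < t"
      and p: "\<And>s. 0 \<le> s \<Longrightarrow> s \<le> t \<Longrightarrow> 0 \<le> poly p s \<and> poly p s \<le> poly p t"
    have "\<bar>poly (pderiv (pcompose p [:0, t:])) 1\<bar> \<le> C * poly p t"
    proof (rule C)
      show "degree (pcompose p [:0, t:]) \<le> d"
        using deg t by (simp add: degree_pcompose)
      show "\<bar>poly (pcompose p [:0, t:]) s\<bar> \<le> poly p t" if "0 \<le> s" "s \<le> 1" for s
        using p[of "s * t"] that t by (simp add: poly_pcompose mult_left_le_one_le)
    qed
    then have "poly (pderiv p) t * t \<le> C * poly p t"
      by (simp add: pderiv_pcompose poly_pcompose pderiv_pCons mult.commute abs_le_iff)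
    then show "poly (pderiv p) t \<le> C / t * poly p t"
      using t by (simp add: field_simps)
  qed (rule C0)
qed

section \<open>The quadratic map of a bracket on bilinear forms\<close>

text \<open>The right-hand side of the equation for \<open>H\<close>, written in the fixed basis so that it makes sense for every bilinear form \<open>F\<close>.\<close>
definition bracket_square :: "'a::euclidean_space bracket \<Rightarrow> ('a \<Rightarrow> 'a \<Rightarrow> real) \<Rightarrow> 'a \<Rightarrow> 'a \<Rightarrow> real" where
  "bracket_square \<mu> F x y = (\<Sum>p\<in>Basis \<times> Basis. \<Sum>r\<in>Basis \<times> Basis.
     (x \<bullet> \<mu> (fst p) (snd p)) * (y \<bullet> \<mu> (fst r) (snd r)) * (F (fst p) (fst r) * F (snd p) (snd r)))"

section \<open>Contraction identities for the quadratic map\<close>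

lemma sum_Times_product:
  fixes g h :: "'i \<Rightarrow> real"
  shows "(\<Sum>q\<in>A \<times> B. g (fst q) * h (snd q)) = sum g A * sum h B"
  by (simp add: sum_product sum.cartesian_product case_prod_beta)

lemma sum_Times_product2:
  fixes g h :: "'i \<Rightarrow> 'i \<Rightarrow> real"
  shows "(\<Sum>p\<in>A \<times> A. \<Sum>r\<in>A \<times> A. g (fst p) (fst r) * h (snd p) (snd r)) =
    (\<Sum>a\<in>A. \<Sum>c\<in>A. g a c) * (\<Sum>b\<in>A. \<Sum>d\<in>A. h b d)"
  by (simp add: sum_Times_product[of "g _" "h _"] sum_Times_product[of "\<lambda>a. sum (g a) A" "\<lambda>b. sum (h b) A"])

lemma inner_bilinear_expand:
  fixes \<mu> :: "'a::euclidean_space bracket"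
  assumes "bilinear \<mu>"
  shows "x \<bullet> \<mu> (\<Sum>a\<in>A. (a \<bullet> u) *\<^sub>R a) (\<Sum>b\<in>B. (b \<bullet> v) *\<^sub>R b) =
    (\<Sum>p\<in>A \<times> B. (x \<bullet> \<mu> (fst p) (snd p)) * ((fst p \<bullet> u) * (snd p \<bullet> v)))"
  using assms
  by (simp add: bilinear_sum bilinear_lmul bilinear_rmul inner_sum_right case_prod_beta)
    (simp add: algebra_simps)

lemma inner_bilinear_expand_Basis:
  fixes \<mu> :: "'a::euclidean_space bracket"
  assumes "bilinear \<mu>"
  shows "x \<bullet> \<mu> u v = (\<Sum>p\<in>Basis \<times> Basis. (x \<bullet> \<mu> (fst p) (snd p)) * ((fst p \<bullet> u) * (snd p \<bullet> v)))"
  using inner_bilinear_expand[OF assms, of x u Basis v Basis]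
  by (simp add: inner_commute[of _ u] inner_commute[of _ v] euclidean_representation)

text \<open>Inserting the Gram factorisation of \<open>F\<close> splits the sum over pairs
  \<open>p\<close>, \<open>r\<close> into a product for each \<open>q = (i, j)\<close>, and each
  factor reassembles to a value of \<open>\<mu>\<close> on the frame. In this form the quadratic map
  is comparable with \<open>Pmap\<close>.\<close>

lemma bracket_square_gram:
  fixes \<mu> :: "'a::euclidean_space bracket" and k :: "'a \<Rightarrow> 'a"
  assumes "bilinear \<mu>"
    and F: "\<And>a c. a \<in> Basis \<Longrightarrow> c \<in> Basis \<Longrightarrow> F a c = (\<Sum>i\<in>Basis. (a \<bullet> k i) * (c \<bullet> k i))"
  shows "bracket_square \<mu> F x y = (\<Sum>i\<in>Basis. \<Sum>j\<in>Basis. (x \<bullet> \<mu> (k i) (k j)) * (y \<bullet> \<mu> (k i) (k j)))"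
proof -
  let ?B = "Basis \<times> Basis :: ('a \<times> 'a) set"
  let ?X = "\<lambda>p. x \<bullet> \<mu> (fst p) (snd p)" and ?Y = "\<lambda>p. y \<bullet> \<mu> (fst p) (snd p)"
  let ?T = "\<lambda>p q. (fst p \<bullet> k (fst q)) * (snd p \<bullet> k (snd q))"
  have "(\<Sum>q\<in>?B. ?T p q * ?T r q) = F (fst p) (fst r) * F (snd p) (snd r)" if "p \<in> ?B" "r \<in> ?B" for p r
    using sum_Times_product[of "\<lambda>i. (fst p \<bullet> k i) * (fst r \<bullet> k i)" "\<lambda>i. (snd p \<bullet> k i) * (snd r \<bullet> k i)" Basis Basis]
      that by (auto simp: F algebra_simps)
  then have "bracket_square \<mu> F x y = (\<Sum>p\<in>?B. \<Sum>r\<in>?B. ?X p * ?Y r * (\<Sum>q\<in>?B. ?T p q * ?T r q))"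
    unfolding bracket_square_def by (intro sum.cong refl) simp
  also have "\<dots> = (\<Sum>p\<in>?B. \<Sum>r\<in>?B. \<Sum>q\<in>?B. (?X p * ?T p q) * (?Y r * ?T r q))"
    unfolding sum_distrib_left by (intro sum.cong refl) (simp only: mult_ac)
  also have "\<dots> = (\<Sum>p\<in>?B. \<Sum>q\<in>?B. \<Sum>r\<in>?B. (?X p * ?T p q) * (?Y r * ?T r q))"
    by (intro sum.cong refl sum.swap)
  also have "\<dots> = (\<Sum>q\<in>?B. \<Sum>p\<in>?B. \<Sum>r\<in>?B. (?X p * ?T p q) * (?Y r * ?T r q))"
    by (rule sum.swap)
  also have "\<dots> = (\<Sum>q\<in>?B. (\<Sum>p\<in>?B. ?X p * ?T p q) * (\<Sum>r\<in>?B. ?Y r * ?T r q))"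
    unfolding sum_product ..
  also have "\<dots> = (\<Sum>q\<in>?B. (x \<bullet> \<mu> (k (fst q)) (k (snd q))) * (y \<bullet> \<mu> (k (fst q)) (k (snd q))))"
    unfolding inner_bilinear_expand_Basis[OF assms(1), of _ "k _" "k _", symmetric] ..
  finally show ?thesis
    by (simp add: sum.cartesian_product case_prod_beta)
qed

text \<open>Triangularity in abstract form: if \<open>x \<bullet> \<mu> u v\<close> and
  \<open>y \<bullet> \<mu> u v\<close> see \<open>u\<close> and \<open>v\<close> only through inner
  products with \<open>E\<close>, then bilinearity of \<open>F\<close> collapses the sums over the
  full basis, and only the values of \<open>F\<close> on \<open>E\<close> remain.\<close>

lemma bracket_square_restrict:
  assumes "bilinear F"
    and X: "\<And>u v. x \<bullet> \<mu> u v = (\<Sum>e\<in>E \<times> E. (x \<bullet> \<mu> (fst e) (snd e)) * ((fst e \<bullet> u) * (snd e \<bullet> v)))"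
    and Y: "\<And>u v. y \<bullet> \<mu> u v = (\<Sum>e\<in>E \<times> E. (y \<bullet> \<mu> (fst e) (snd e)) * ((fst e \<bullet> u) * (snd e \<bullet> v)))"
  shows "bracket_square \<mu> F x y = (\<Sum>e\<in>E \<times> E. \<Sum>f\<in>E \<times> E.
     (x \<bullet> \<mu> (fst e) (snd e)) * (y \<bullet> \<mu> (fst f) (snd f)) * (F (fst e) (fst f) * F (snd e) (snd f)))"
proof -
  let ?B = "Basis \<times> Basis :: ('a \<times> 'a) set"
  let ?X = "\<lambda>p. x \<bullet> \<mu> (fst p) (snd p)" and ?Y = "\<lambda>p. y \<bullet> \<mu> (fst p) (snd p)"
  let ?S = "\<lambda>e p. (fst e \<bullet> fst p) * (snd e \<bullet> snd p)"
  let ?G = "\<lambda>p r. F (fst p) (fst r) * F (snd p) (snd r)"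
  have F: "F a c = (\<Sum>u\<in>Basis. \<Sum>w\<in>Basis. (a \<bullet> u) * (c \<bullet> w) * F u w)" for a c
    using bilinear_sum[OF assms(1), of "\<lambda>u. (a \<bullet> u) *\<^sub>R u" Basis "\<lambda>u. (c \<bullet> u) *\<^sub>R u" Basis]
    by (simp add: euclidean_representation bilinear_lmul[OF assms(1)] bilinear_rmul[OF assms(1)]
        sum.cartesian_product case_prod_beta mult_ac)
  have G: "(\<Sum>p\<in>?B. \<Sum>r\<in>?B. ?S e p * ?S f r * ?G p r) = ?G e f" for e f
    using sum_Times_product2[of "\<lambda>u w. (fst e \<bullet> u) * (fst f \<bullet> w) * F u w"
        "\<lambda>u w. (snd e \<bullet> u) * (snd f \<bullet> w) * F u w" Basis]
    unfolding F[symmetric] by (simp add: mult_ac)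
  have "bracket_square \<mu> F x y =
    (\<Sum>p\<in>?B. \<Sum>r\<in>?B. (\<Sum>e\<in>E\<times>E. ?X e * ?S e p) * (\<Sum>f\<in>E\<times>E. ?Y f * ?S f r) * ?G p r)"
    unfolding bracket_square_def by (subst X, subst Y) (rule refl)
  also have "\<dots> = (\<Sum>p\<in>?B. \<Sum>r\<in>?B. \<Sum>e\<in>E\<times>E. \<Sum>f\<in>E\<times>E. ?X e * ?Y f * (?S e p * ?S f r * ?G p r))"
    unfolding sum_product unfolding sum_distrib_right by (intro sum.cong refl) (simp only: mult_ac)
  also have "\<dots> = (\<Sum>p\<in>?B. \<Sum>e\<in>E\<times>E. \<Sum>f\<in>E\<times>E. \<Sum>r\<in>?B. ?X e * ?Y f * (?S e p * ?S f r * ?G p r))"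
    by (subst sum.swap[of _ _ ?B], subst sum.swap[of _ _ ?B]) (rule refl)
  also have "\<dots> = (\<Sum>e\<in>E\<times>E. \<Sum>f\<in>E\<times>E. \<Sum>p\<in>?B. \<Sum>r\<in>?B. ?X e * ?Y f * (?S e p * ?S f r * ?G p r))"
    by (subst sum.swap[of _ _ ?B], subst sum.swap[of _ _ ?B]) (rule refl)
  also have "\<dots> = (\<Sum>e\<in>E\<times>E. \<Sum>f\<in>E\<times>E. ?X e * ?Y f * ?G e f)"
    unfolding sum_distrib_left[symmetric] G ..
  finally show ?thesis .
qed

section \<open>Annihilators of the lower central series\<close>

lemma subspace_lcs: "subspace (lcs \<mu> k)"
  by (cases k) auto

text \<open>If \<open>x\<close> annihilates \<open>lcs \<mu> (Suc k)\<close>, then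
  \<open>x \<bullet> \<mu> u v\<close> vanishes once \<open>v\<close> lies in
  \<open>lcs \<mu> k\<close>, and by skew-symmetry once \<open>u\<close> does. So both arguments may
  be projected orthogonally to the complement of \<open>lcs \<mu> k\<close>, of which
  \<open>E\<close> is an orthonormal basis.\<close>

lemma lcs_adapted_basis:
  fixes \<mu> :: "'a::euclidean_space bracket"
  assumes "is_bracket \<mu>"
  obtains E where "finite E" "E \<subseteq> (lcs \<mu> k)\<^sup>\<bottom>"
    "\<And>x u v. x \<in> (lcs \<mu> (Suc k))\<^sup>\<bottom> \<Longrightarrow>
      x \<bullet> \<mu> u v = (\<Sum>e\<in>E \<times> E. (x \<bullet> \<mu> (fst e) (snd e)) * ((fst e \<bullet> u) * (snd e \<bullet> v)))"
proof -
  have bil: "bilinear \<mu>" and skew: "\<And>x y. \<mu> x y = - \<mu> y x"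
    using assms unfolding is_bracket_def by blast+
  obtain E where E: "E \<subseteq> (lcs \<mu> k)\<^sup>\<bottom>" "pairwise orthogonal E" "\<And>x. x \<in> E \<Longrightarrow> norm x = 1"
    "independent E" "span E = (lcs \<mu> k)\<^sup>\<bottom>"
    using orthonormal_basis_subspace[OF subspace_orthogonal_comp[of "lcs \<mu> k"]] by metis
  have fin: "finite E" using E(4) by (rule independent_imp_finite)
  define pr where "pr u = (\<Sum>a\<in>E. (a \<bullet> u) *\<^sub>R a)" for u
  have inner_E: "a \<bullet> b = (if a = b then 1 else 0)" if "a \<in> E" "b \<in> E" for a b
    using E(2,3) that by (auto simp: pairwise_def orthogonal_def norm_eq_1)
  have pr: "u - pr u \<in> lcs \<mu> k" for u
  proof -
    have "orthogonal (u - pr u) a" if "a \<in> E" for a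
    proof -
      have "pr u \<bullet> a = (\<Sum>b\<in>E. if b = a then b \<bullet> u else 0)"
        unfolding pr_def inner_sum_left using that by (intro sum.cong) (auto simp: inner_E)
      then show ?thesis
        using that fin by (simp add: orthogonal_def inner_diff_left inner_diff_right inner_commute)
    qed
    then have "\<forall>z\<in>span E. orthogonal z (u - pr u)"
      using orthogonal_to_span orthogonal_commute by metis
    then have "u - pr u \<in> (lcs \<mu> k)\<^sup>\<bottom>\<^sup>\<bottom>"
      unfolding E(5) orthogonal_comp_def by simp
    then show ?thesis by (simp add: orthogonal_comp_self[OF subspace_lcs])
  qed
  show ?thesis
  proof
    fix x u v assume x: "x \<in> (lcs \<mu> (Suc k))\<^sup>\<bottom>"
    have right0: "x \<bullet> \<mu> w z = 0" if "z \<in> lcs \<mu> k" for w z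
    proof -
      have "\<mu> w z \<in> lcs \<mu> (Suc k)" using that by (auto intro!: span_base)
      then show ?thesis using x by (auto simp: orthogonal_comp_def orthogonal_def inner_commute)
    qed
    have left0: "x \<bullet> \<mu> z w = 0" if "z \<in> lcs \<mu> k" for w z
      using right0[OF that, of w] skew[of z w] by simp
    have "x \<bullet> \<mu> u v = x \<bullet> \<mu> (pr u) (pr v)"
      using left0[OF pr, of u v] right0[OF pr, of "pr u" v]
      by (simp add: bilinear_lsub[OF bil] bilinear_rsub[OF bil] inner_diff_right)
    then show "x \<bullet> \<mu> u v = (\<Sum>e\<in>E \<times> E. (x \<bullet> \<mu> (fst e) (snd e)) * ((fst e \<bullet> u) * (snd e \<bullet> v)))"
      unfolding pr_def inner_bilinear_expand[OF bil] .
  qed (use fin E in auto)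
qed

section \<open>Positive semidefinite forms and their Gram vectors\<close>

lemma psd_Cauchy_Schwarz:
  fixes F :: "'a::real_vector \<Rightarrow> 'a \<Rightarrow> real"
  assumes bil: "bilinear F" and sym: "\<And>x y. F x y = F y x" and psd: "\<And>x. 0 \<le> F x x"
  shows "(F x y)\<^sup>2 \<le> F x x * F y y"
proof -
  have q: "0 \<le> F x x * s\<^sup>2 + 2 * F x y * s * t + F y y * t\<^sup>2" for s t
    using psd[of "s *\<^sub>R x + t *\<^sub>R y"] sym[of y x]
    by (simp add: bilinear_ladd[OF bil] bilinear_radd[OF bil] bilinear_lmul[OF bil]
        bilinear_rmul[OF bil] algebra_simps power2_eq_square)
  show ?thesis
  proof (cases "F y y = 0")
    case True
    have "F x y = 0"
    proof (rule ccontr)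
      assume "F x y \<noteq> 0"
      \<comment> \<open>For \<open>F y y = 0\<close> the form \<open>q\<close> is affine in its
        second argument; this value makes it equal to \<open>-1\<close>.\<close>
      then show False using q[of 1 "- (F x x + 1) / (2 * F x y)"] True by simp
    qed
    then show ?thesis using True by simp
  next
    case False
    then have "0 < F y y" using psd[of y] by simp
    moreover have "0 \<le> F y y * (F x x * F y y - (F x y)\<^sup>2)"
      using q[of "F y y" "- F x y"] by (simp add: algebra_simps power2_eq_square)
    ultimately show ?thesis by (simp add: zero_le_mult_iff)
  qed
qed

text \<open>Symmetric Gaussian elimination, one basis vector at a time.\<close>
lemma psd_gram_exists:
  fixes F :: "'a::euclidean_space \<Rightarrow> 'a \<Rightarrow> real"
  assumes "bilinear F" "\<And>x y. F x y = F y x" "\<And>x. 0 \<le> F x x"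
  obtains k :: "'a \<Rightarrow> 'a" where "\<And>x y. F x y = (\<Sum>i\<in>Basis. (x \<bullet> k i) * (y \<bullet> k i))"
proof -
  \<comment> \<open>\<open>S\<close> holds the basis vectors still to be eliminated; the form
    already vanishes on all others.\<close>
  have "\<exists>k :: 'a \<Rightarrow> 'a. \<forall>x y. F x y = (\<Sum>i\<in>S. (x \<bullet> k i) * (y \<bullet> k i))"
    if "finite S" "bilinear F" "\<And>x y. F x y = F y x" "\<And>x. 0 \<le> F x x"
      "\<And>b x. b \<in> Basis - S \<Longrightarrow> F b x = 0"
    for S and F :: "'a \<Rightarrow> 'a \<Rightarrow> real"
    using that
  proof (induction S arbitrary: F rule: finite_induct)
    case empty
    have "F x y = 0" for x y
      using linear_expand_Basis[of "\<lambda>x. F x y" x] empty.prems(1,4) by (auto simp: bilinear_def)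
    then show ?case by simp
  next
    case (insert b S)
    note bil = insert.prems(1) and sym = insert.prems(2) and psd = insert.prems(3)
    note CS = psd_Cauchy_Schwarz[OF bil sym psd]
    define r where "r = (\<Sum>c\<in>Basis. F b c *\<^sub>R c)"
    have r: "x \<bullet> r = F b x" for x
      using linear_expand_Basis[of "F b" x] bil
      by (simp add: r_def bilinear_def inner_sum_right mult.commute)
    \<comment> \<open>The Schur complement with respect to \<open>b\<close>. If
      \<open>F b b = 0\<close>, division by zero gives \<open>F' = F\<close>, the new Gram vector is
      0, and Cauchy-Schwarz shows that \<open>F b\<close> vanishes already.\<close>
    define F' where "F' x y = F x y - (F b x) * (F b y) / F b b" for x y
    have bil': "bilinear F'"
      unfolding bilinear_def F'_def
      by (auto intro!: linearI simp: bilinear_ladd[OF bil] bilinear_radd[OF bil] bilinear_lmul[OF bil]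
          bilinear_rmul[OF bil] algebra_simps add_divide_distrib)
    have F'0: "F' c x = 0" if "c \<in> Basis - S" for c x
    proof (cases "c = b")
      case True
      then show ?thesis using CS[of b x] by (cases "F b b = 0") (auto simp: F'_def)
    next
      case False
      then show ?thesis using insert.prems(4)[of c x] insert.prems(4)[of c b] sym[of b c] that
        by (simp add: F'_def)
    qed
    have psd': "0 \<le> F' x x" for x
      using CS[of b x] psd[of b] psd[of x]
      by (cases "F b b = 0") (auto simp: F'_def field_simps power2_eq_square)
    obtain k where k: "\<And>x y. F' x y = (\<Sum>i\<in>S. (x \<bullet> k i) * (y \<bullet> k i))"
      using insert.IH[OF bil' _ psd' F'0] sym by (auto simp: F'_def mult.commute)
    have "F x y = (\<Sum>i\<in>insert b S. (x \<bullet> (k(b := r /\<^sub>R sqrt (F b b))) i) * (y \<bullet> (k(b := r /\<^sub>R sqrt (F b b))) i))"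
      for x y
    proof -
      have "(\<Sum>i\<in>S. (x \<bullet> (k(b := r /\<^sub>R sqrt (F b b))) i) * (y \<bullet> (k(b := r /\<^sub>R sqrt (F b b))) i)) = F' x y"
        unfolding k using insert.hyps by (intro sum.cong) auto
      moreover have "sqrt (F b b) * sqrt (F b b) = F b b" using psd[of b] by simp
      ultimately show ?thesis
        using insert.hyps by (simp add: r F'_def divide_simps)
    qed
    then show ?case by blast
  qed
  from this[of Basis F] show ?thesis using assms that by auto
qed

text \<open>Gram vectors of \<open>F\<close> turn the value on the diagonal into a sum of
  squares.\<close>

lemma bracket_square_nonneg:
  fixes \<mu> :: "'a::euclidean_space bracket"
  assumes "bilinear \<mu>" "bilinear F" "\<And>x y. F x y = F y x" "\<And>x. 0 \<le> F x x"
  shows "0 \<le> bracket_square \<mu> F x x"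
proof -
  obtain k :: "'a \<Rightarrow> 'a" where "\<And>x y. F x y = (\<Sum>i\<in>Basis. (x \<bullet> k i) * (y \<bullet> k i))"
    using psd_gram_exists[OF assms(2-4)] by blast
  then show ?thesis
    using bracket_square_gram[OF assms(1), of F k x x] by (simp add: sum_nonneg)
qed

section \<open>Upper bound along the flow\<close>

lemma Pmap_inner: "Pmap \<nu> x \<bullet> y = (\<Sum>i\<in>Basis. \<Sum>j\<in>Basis. (x \<bullet> \<nu> i j) * (y \<bullet> \<nu> i j)) / 2"
  by (simp add: Pmap_def inner_sum_left inner_commute[of y])

lemma Pmap_symmetric: "Pmap \<nu> x \<bullet> y = x \<bullet> Pmap \<nu> y"
  by (simp add: Pmap_inner inner_commute[of x "Pmap \<nu> y"] mult.commute)

lemma linear_Pmap: "linear (Pmap \<nu>)"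
proof (rule linearI)
  show "Pmap \<nu> (x + y) = Pmap \<nu> x + Pmap \<nu> y" for x y
    by (simp add: Pmap_def inner_add_left scaleR_add_left sum.distrib scaleR_add_right)
  show "Pmap \<nu> (c *\<^sub>R x) = c *\<^sub>R Pmap \<nu> x" for c x
    by (simp add: Pmap_def scaleR_sum_right mult_ac)
qed

lemma bnorm2_eq_trace_Pmap: "bnorm2 \<nu> = (\<Sum>b\<in>Basis. Pmap \<nu> b \<bullet> b)"
proof -
  have "(\<Sum>b\<in>Basis. Pmap \<nu> b \<bullet> b) = (\<Sum>b\<in>Basis. \<Sum>i\<in>Basis. \<Sum>j\<in>Basis. (b \<bullet> \<nu> i j) * (b \<bullet> \<nu> i j)) / 2"
    by (simp add: Pmap_inner sum_divide_distrib)
  also have "(\<Sum>b\<in>Basis. \<Sum>i\<in>Basis. \<Sum>j\<in>Basis. (b \<bullet> \<nu> i j) * (b \<bullet> \<nu> i j)) =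
      (\<Sum>i\<in>Basis. \<Sum>j\<in>Basis. \<Sum>b\<in>Basis. (b \<bullet> \<nu> i j) * (b \<bullet> \<nu> i j))"
    by (subst sum.swap, subst (2) sum.swap) (rule refl)
  also have "\<dots> = (\<Sum>i\<in>Basis. \<Sum>j\<in>Basis. (norm (\<nu> i j))\<^sup>2)"
    by (simp add: power2_norm_eq_inner inner_commute euclidean_inner[of "\<nu> _ _" "\<nu> _ _"])
  finally show ?thesis by (simp add: bnorm2_def)
qed

lemma bilinear_pi_act:
  assumes "linear A" "bilinear \<nu>"
  shows "bilinear (pi_act A \<nu>)"
  unfolding bilinear_def pi_act_def
  by (auto intro!: linearI simp: bilinear_ladd[OF assms(2)] bilinear_radd[OF assms(2)]
      bilinear_lmul[OF assms(2)] bilinear_rmul[OF assms(2)] linear_add[OF assms(1)]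
      linear_scale[OF assms(1)] algebra_simps)

lemma bilinear_expand_Basis:
  fixes h :: "'a::euclidean_space \<Rightarrow> 'a \<Rightarrow> 'b::real_vector"
  assumes "bilinear h"
  shows "h x y = (\<Sum>p\<in>Basis \<times> Basis. ((x \<bullet> fst p) * (y \<bullet> snd p)) *\<^sub>R h (fst p) (snd p))"
  using bilinear_sum[OF assms, of "\<lambda>i. (x \<bullet> i) *\<^sub>R i" Basis "\<lambda>i. (y \<bullet> i) *\<^sub>R i" Basis]
  by (simp add: euclidean_representation bilinear_lmul[OF assms] bilinear_rmul[OF assms] case_prod_beta mult.commute)

text \<open>The product rule when the bilinear map varies as well. Expansion in the basis reduces it
  to scalar products with the pointwise derivatives of \<open>m\<close>.\<close>

lemma bilinear_family_has_vector_derivative: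
  fixes m :: "real \<Rightarrow> 'a::euclidean_space \<Rightarrow> 'a \<Rightarrow> 'b::real_normed_vector"
  assumes bil: "\<And>s. s \<in> S \<Longrightarrow> bilinear (m s)" and "t \<in> S" and bil': "bilinear m'"
    and m: "\<And>x y. ((\<lambda>s. m s x y) has_vector_derivative m' x y) (at t within S)"
    and u: "(u has_vector_derivative u') (at t within S)"
    and v: "(v has_vector_derivative v') (at t within S)"
  shows "((\<lambda>s. m s (u s) (v s)) has_vector_derivative m' (u t) (v t) + m t u' (v t) + m t (u t) v') (at t within S)"
proof (rule has_vector_derivative_transform[OF \<open>t \<in> S\<close>])
  let ?B = "Basis \<times> Basis :: ('a \<times> 'a) set"
  show "m s (u s) (v s) = (\<Sum>p\<in>?B. ((u s \<bullet> fst p) * (v s \<bullet> snd p)) *\<^sub>R m s (fst p) (snd p))" if "s \<in> S" for s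
    by (rule bilinear_expand_Basis[OF bil[OF that]])
  have ip: "((\<lambda>s. w s \<bullet> b) has_vector_derivative w' \<bullet> b) (at t within S)"
    if "(w has_vector_derivative w') (at t within S)" for w :: "real \<Rightarrow> 'a" and w' b
    using bounded_linear.has_vector_derivative[OF bounded_linear_inner_left that] .
  have "((\<lambda>s. \<Sum>p\<in>?B. ((u s \<bullet> fst p) * (v s \<bullet> snd p)) *\<^sub>R m s (fst p) (snd p)) has_vector_derivative
     (\<Sum>p\<in>?B. ((u t \<bullet> fst p) * (v t \<bullet> snd p)) *\<^sub>R m' (fst p) (snd p) +
       ((u t \<bullet> fst p) * (v' \<bullet> snd p) + (u' \<bullet> fst p) * (v t \<bullet> snd p)) *\<^sub>R m t (fst p) (snd p))) (at t within S)"
    by (intro has_vector_derivative_sum has_vector_derivative_scaleR m)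
      (use has_vector_derivative_mult[OF ip[OF u] ip[OF v]] in
        \<open>simp add: has_real_derivative_iff_has_vector_derivative\<close>)
  moreover have "(\<Sum>p\<in>?B. ((u t \<bullet> fst p) * (v t \<bullet> snd p)) *\<^sub>R m' (fst p) (snd p) +
       ((u t \<bullet> fst p) * (v' \<bullet> snd p) + (u' \<bullet> fst p) * (v t \<bullet> snd p)) *\<^sub>R m t (fst p) (snd p)) =
      m' (u t) (v t) + m t u' (v t) + m t (u t) v'"
    unfolding bilinear_expand_Basis[OF bil', of "u t" "v t"]
      bilinear_expand_Basis[OF bil[OF \<open>t \<in> S\<close>], of "u t" v'] bilinear_expand_Basis[OF bil[OF \<open>t \<in> S\<close>], of u' "v t"]
    by (simp add: sum.distrib scaleR_add_left)
  ultimately show "((\<lambda>s. \<Sum>p\<in>?B. ((u s \<bullet> fst p) * (v s \<bullet> snd p)) *\<^sub>R m s (fst p) (snd p)) has_vector_derivative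
     m' (u t) (v t) + m t u' (v t) + m t (u t) v') (at t within S)" by simp
qed

lemmas has_vector_derivative_inner =
  bounded_bilinear.has_vector_derivative[OF bounded_bilinear_inner]

context
  fixes \<mu> :: "'a::euclidean_space bracket" and m
  assumes sol: "bracket_flow_solution \<mu> m"
begin

lemma flow_bilinear: "0 \<le> t \<Longrightarrow> bilinear (m t)"
  and flow_derivative: "0 \<le> t \<Longrightarrow>
    ((\<lambda>s. m s x y) has_vector_derivative - pi_act (Pmap (m t)) (m t) x y) (at t within {0..})"
  and flow_initial: "m 0 = \<mu>"
  using sol unfolding bracket_flow_solution_def is_bracket_def by blast+

lemma flow_continuous: "continuous_on {0..} (\<lambda>t. m t x y)"
  by (rule continuous_on_has_vector_derivative[where f' = "\<lambda>t. - pi_act (Pmap (m t)) (m t) x y"])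
    (simp add: flow_derivative)

text \<open>\<open>K\<close> is \<open>h\<^sup>-\<^sup>T\<close> in the notation of the introduction; the auxiliary \<open>W\<close> in the proof is \<open>h\<close>.\<close>
lemma flow_gauge_exists:
  obtains K where "\<And>t. linear (K t)" "\<And>x. K 0 x = x"
    "\<And>t x. 0 \<le> t \<Longrightarrow> ((\<lambda>s. K s x) has_vector_derivative Pmap (m t) (K t x)) (at t within {0..})"
    "\<And>t. 0 \<le> t \<Longrightarrow> surj (K t)"
    "\<And>t x y z. 0 \<le> t \<Longrightarrow> K t z \<bullet> m t x y = z \<bullet> \<mu> (adjoint (K t) x) (adjoint (K t) y)"
proof -
  let ?P = "\<lambda>t. Pmap (m t)"
  have contP: "continuous_on {0..} (\<lambda>t. ?P t x)" for x
    unfolding Pmap_def by (intro continuous_intros flow_continuous)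
  obtain K where linK: "\<And>t. linear (K t)" and K0: "\<And>x. K 0 x = x" and
    K: "\<And>t x. 0 \<le> t \<Longrightarrow> ((\<lambda>s. K s x) has_vector_derivative ?P t (K t x)) (at t within {0..})"
    using linear_ode_flow_exists[of ?P, OF linear_Pmap contP] by blast
  have "linear (\<lambda>x. - ?P t x)" for t
    using linear_compose_neg[OF linear_Pmap] .
  then obtain W where linW: "\<And>t. linear (W t)" and W0: "\<And>x. W 0 x = x" and
    W: "\<And>t x. 0 \<le> t \<Longrightarrow> ((\<lambda>s. W s x) has_vector_derivative - ?P t (W t x)) (at t within {0..})"
    using linear_ode_flow_exists[of "\<lambda>t x. - ?P t x"] continuous_on_minus[OF contP] by blast
  \<comment> \<open>\<open>P\<close> is symmetric, so the equations of \<open>K\<close> and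
    \<open>W\<close> are adjoint to each other and the pairing is conserved. Thus \<open>W t\<close>
    is the inverse transpose of \<open>K t\<close>.\<close>
  have KW: "K t x \<bullet> W t y = x \<bullet> y" if "0 \<le> t" for t x y
  proof -
    have "((\<lambda>s. K s x \<bullet> W s y) has_vector_derivative 0) (at s within {0..})" if "0 \<le> s" for s
      using has_vector_derivative_inner[OF K[OF that, of x] W[OF that, of y]]
      by (simp add: Pmap_symmetric)
    from eq_initial_value[OF this \<open>0 \<le> t\<close>] show ?thesis by (simp add: K0 W0)
  qed
  \<comment> \<open>Differentiating \<open>m (W x) (W y)\<close>, the two terms from
    \<open>W\<close> cancel the last two terms of \<open>pi_act\<close>. What is left is
    \<open>- P (m (W x) (W y))\<close>, which cancels against the derivative of \<open>K z\<close>.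
    So the flow only moves \<open>\<mu>\<close> by a change of basis.\<close>
  have const: "K t z \<bullet> m t (W t x) (W t y) = z \<bullet> \<mu> x y" if "0 \<le> t" for t x y z
  proof -
    have "((\<lambda>s. K s z \<bullet> m s (W s x) (W s y)) has_vector_derivative 0) (at s within {0..})" if "0 \<le> s" for s
    proof -
      have b': "bilinear (\<lambda>x y. - pi_act (?P s) (m s) x y)"
        using bilinear_pi_act[OF linear_Pmap flow_bilinear[OF that]]
        by (auto simp: bilinear_def intro: linear_compose_neg)
      have "((\<lambda>r. m r (W r x) (W r y)) has_vector_derivative
          - pi_act (?P s) (m s) (W s x) (W s y) + m s (- ?P s (W s x)) (W s y) + m s (W s x) (- ?P s (W s y)))
          (at s within {0..})"
        using that by (intro bilinear_family_has_vector_derivative[OF _ _ b'] flow_derivative flow_bilinear W) auto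
      then have "((\<lambda>r. m r (W r x) (W r y)) has_vector_derivative - ?P s (m s (W s x) (W s y))) (at s within {0..})"
        by (simp add: pi_act_def bilinear_lneg[OF flow_bilinear[OF that]] bilinear_rneg[OF flow_bilinear[OF that]])
      from has_vector_derivative_inner[OF K[OF that, of z] this] show ?thesis
        by (simp add: Pmap_symmetric)
    qed
    from eq_initial_value[OF this \<open>0 \<le> t\<close>] show ?thesis by (simp add: K0 W0 flow_initial)
  qed
  show ?thesis
  proof (rule that[OF linK K0 K])
    fix t :: real assume t: "0 \<le> t"
    have "adjoint (K t) (W t y) = y" for y
      by (rule euclidean_eqI) (metis KW[OF t] adjoint_clauses(2)[OF linK] inner_commute)
    then have "adjoint (K t) \<circ> W t = id" by auto
    then have WK: "W t \<circ> adjoint (K t) = id"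
      using linear_inverse_left[OF adjoint_linear[OF linK] linW] by blast
    have "adjoint (W t) (K t y) = y" for y
      by (rule euclidean_eqI) (metis KW[OF t] adjoint_clauses(2)[OF linW] inner_commute)
    then have "adjoint (W t) \<circ> K t = id" by auto
    then have "K t \<circ> adjoint (W t) = id"
      using linear_inverse_left[OF adjoint_linear[OF linW] linK] by blast
    then show "surj (K t)" by (metis comp_eq_dest_lhs id_apply surjI)
    show "K t z \<bullet> m t x y = z \<bullet> \<mu> (adjoint (K t) x) (adjoint (K t) y)" for x y z
      using const[OF t, of z "adjoint (K t) x" "adjoint (K t) y"] WK by (simp add: fun_eq_iff)
  qed
qed

end

lemma Pmap_nonneg: "0 \<le> Pmap \<nu> x \<bullet> x"
  by (simp add: Pmap_inner sum_nonneg)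

text \<open>The degree bound must precede the quantifier over \<open>H\<close>: the constant in the theorem has to serve all solutions.\<close>
lemma bracket_square_flow_poly:
  fixes \<mu> :: "'a::euclidean_space bracket"
  assumes "is_bracket \<mu>"
  shows "\<exists>d. \<forall>H. (\<forall>t\<ge>0. bilinear (H t)) \<and>
      (\<forall>t\<ge>0. \<forall>x y. ((\<lambda>s. H s x y) has_vector_derivative bracket_square \<mu> (H t) x y) (at t within {0..})) \<longrightarrow>
    (\<forall>x\<in>(lcs \<mu> k)\<^sup>\<bottom>. \<forall>y\<in>(lcs \<mu> k)\<^sup>\<bottom>. \<exists>p. degree p \<le> d \<and> (\<forall>t\<ge>0. H t x y = poly p t))"
proof (induction k)
  case 0
  show ?case
    by (auto intro!: exI[of _ 0] simp: bilinear_lzero)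
next
  case (Suc k)
  then obtain d where d: "\<And>H x y. \<lbrakk>\<And>t. 0 \<le> t \<Longrightarrow> bilinear (H t);
      \<And>t x y. 0 \<le> t \<Longrightarrow> ((\<lambda>s. H s x y) has_vector_derivative bracket_square \<mu> (H t) x y) (at t within {0..});
      x \<in> (lcs \<mu> k)\<^sup>\<bottom>; y \<in> (lcs \<mu> k)\<^sup>\<bottom>\<rbrakk> \<Longrightarrow> \<exists>p. degree p \<le> d \<and> (\<forall>t\<ge>0. H t x y = poly p t)"
    by metis
  obtain E where E: "finite E" "E \<subseteq> (lcs \<mu> k)\<^sup>\<bottom>"
    "\<And>x u v. x \<in> (lcs \<mu> (Suc k))\<^sup>\<bottom> \<Longrightarrow>
      x \<bullet> \<mu> u v = (\<Sum>e\<in>E \<times> E. (x \<bullet> \<mu> (fst e) (snd e)) * ((fst e \<bullet> u) * (snd e \<bullet> v)))"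
    using lcs_adapted_basis[OF assms, of k] by blast
  show ?case
  \<comment> \<open>The derivative is a combination of products of two polynomials of degree at most
    \<open>d\<close>; integration adds one more degree.\<close>
  proof (intro exI[of _ "Suc (d + d)"] allI impI ballI, elim conjE)
    fix H x y
    assume x: "x \<in> (lcs \<mu> (Suc k))\<^sup>\<bottom>" and y: "y \<in> (lcs \<mu> (Suc k))\<^sup>\<bottom>"
      and bil: "\<forall>t\<ge>0. bilinear (H t)"
      and der: "\<forall>t\<ge>0. \<forall>x y. ((\<lambda>s. H s x y) has_vector_derivative bracket_square \<mu> (H t) x y) (at t within {0..})"
    have "\<forall>a\<in>E. \<forall>c\<in>E. \<exists>p. degree p \<le> d \<and> (\<forall>t\<ge>0. H t a c = poly p t)"
      using d[of H] bil der E(2) by blast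
    then obtain p where p: "\<And>a c. a \<in> E \<Longrightarrow> c \<in> E \<Longrightarrow> degree (p a c) \<le> d"
      "\<And>a c t. a \<in> E \<Longrightarrow> c \<in> E \<Longrightarrow> 0 \<le> t \<Longrightarrow> H t a c = poly (p a c) t" by metis
    define q where "q = (\<Sum>e\<in>E \<times> E. \<Sum>f\<in>E \<times> E. smult ((x \<bullet> \<mu> (fst e) (snd e)) * (y \<bullet> \<mu> (fst f) (snd f)))
      (p (fst e) (fst f) * p (snd e) (snd f)))"
    have degq: "degree q \<le> d + d"
      unfolding q_def
      by (intro degree_sum_le finite_cartesian_product E order_trans[OF degree_smult_le]
          order_trans[OF degree_mult_le] add_mono p) auto
    have q: "bracket_square \<mu> (H t) x y = poly q t" if "0 \<le> t" for t
      unfolding bracket_square_restrict[OF bil[rule_format, OF that] E(3)[OF x] E(3)[OF y]] q_def poly_sum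
      using that by (intro sum.cong refl) (auto simp: p)
    obtain r where r: "pderiv r = q" "poly r 0 = 0" "degree r \<le> Suc (degree q)"
      using poly_antiderivative_exists by blast
    have der0: "((\<lambda>s. H s x y - poly r s) has_vector_derivative 0) (at t within {0..})" if "0 \<le> t" for t
      using has_vector_derivative_diff[OF der[rule_format, OF that, of x y]
          has_vector_derivative_at_within[OF poly_DERIV[of r t, unfolded has_real_derivative_iff_has_vector_derivative]]]
      by (simp add: q[OF that] r)
    have "\<forall>t\<ge>0. H t x y = poly ([:H 0 x y:] + r) t"
    proof (intro allI impI)
      fix t :: real assume "0 \<le> t"
      from eq_initial_value[OF der0 this] show "H t x y = poly ([:H 0 x y:] + r) t" by (simp add: r(2))
    qed
    moreover have "degree ([:H 0 x y:] + r) \<le> Suc (d + d)"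
      using r(3) degq by (intro degree_add_le) auto
    ultimately show "\<exists>p. degree p \<le> Suc (d + d) \<and> (\<forall>t\<ge>0. H t x y = poly p t)" by blast
  qed
qed

lemma flow_upper_bound:
  fixes \<mu> :: "'a::euclidean_space bracket"
  assumes "is_bracket \<mu>" "nilpotent_bracket \<mu>"
  obtains C where "0 \<le> C" "\<And>m t. bracket_flow_solution \<mu> m \<Longrightarrow> 0 < t \<Longrightarrow> bnorm2 (m t) \<le> C / t"
proof -
  obtain k where k: "lcs \<mu> k = {0}" using assms(2) by (auto simp: nilpotent_bracket_def)
  \<comment> \<open>As \<open>lcs \<mu> k\<close> is zero, its annihilator is the whole space, so
    one \<open>d\<close> serves all \<open>x\<close> and \<open>y\<close>.\<close>
  obtain d where d: "\<And>H x y. \<lbrakk>\<And>t. 0 \<le> t \<Longrightarrow> bilinear (H t);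
      \<And>t x y. 0 \<le> t \<Longrightarrow> ((\<lambda>s. H s x y) has_vector_derivative bracket_square \<mu> (H t) x y) (at t within {0..})\<rbrakk>
      \<Longrightarrow> \<exists>p. degree p \<le> d \<and> (\<forall>t\<ge>0. H t x y = poly p t)"
    using bracket_square_flow_poly[OF assms(1), of k] unfolding k orthogonal_comp_null ball_UNIV by metis
  obtain C :: real where C0: "0 \<le> C" and C: "\<And>p t. degree p \<le> d \<Longrightarrow> 0 < t \<Longrightarrow>
      (\<And>s. 0 \<le> s \<Longrightarrow> s \<le> t \<Longrightarrow> 0 \<le> poly p s \<and> poly p s \<le> poly p t) \<Longrightarrow> poly (pderiv p) t \<le> C / t * poly p t"
    using nondecreasing_poly_deriv_bound by blast
  show ?thesis
  proof
    \<comment> \<open>The trace adds up \<open>DIM('a)\<close> diagonal entries of \<open>P\<close>,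
      each at most \<open>C / (2 t)\<close>.\<close>
    show "0 \<le> real DIM('a) * C / 2" using C0 by simp
    fix m and t :: real assume sol: "bracket_flow_solution \<mu> m" and t: "0 < t"
    obtain K where linK: "\<And>t. linear (K t)" and "\<And>x. K 0 x = x" and K:
      "\<And>t x. 0 \<le> t \<Longrightarrow> ((\<lambda>s. K s x) has_vector_derivative Pmap (m t) (K t x)) (at t within {0..})"
      and surjK: "\<And>t. 0 \<le> t \<Longrightarrow> surj (K t)"
      and Km: "\<And>t x y z. 0 \<le> t \<Longrightarrow> K t z \<bullet> m t x y = z \<bullet> \<mu> (adjoint (K t) x) (adjoint (K t) y)"
      by (rule flow_gauge_exists[OF sol]) blast
    define H where "H t x y = K t x \<bullet> K t y" for t x y
    have bil: "bilinear (H t)" for t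
      unfolding bilinear_def H_def
      by (auto intro!: linearI simp: linear_add[OF linK] linear_scale[OF linK] inner_add_left inner_add_right)
    have derP: "((\<lambda>s. H s x y) has_vector_derivative 2 * (Pmap (m t) (K t x) \<bullet> K t y)) (at t within {0..})"
      if "0 \<le> t" for t x y
      using has_vector_derivative_inner[OF K[OF that, of x] K[OF that, of y]]
      by (simp add: Pmap_symmetric H_def)
    \<comment> \<open>The vectors \<open>adjoint (K t) i\<close> are Gram vectors of
      \<open>H t\<close>, and \<open>Km\<close> turns the sum over this frame into twice the form of
      \<open>Pmap (m t)\<close>. So \<open>H\<close> satisfies the quadratic equation.\<close>
    have sq: "bracket_square \<mu> (H t) x y = 2 * (Pmap (m t) (K t x) \<bullet> K t y)" if "0 \<le> t" for t x y
    proof -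
      have "H t a c = (\<Sum>i\<in>Basis. (a \<bullet> adjoint (K t) i) * (c \<bullet> adjoint (K t) i))" for a c
        unfolding H_def adjoint_works[OF linK] by (rule euclidean_inner)
      then have "bracket_square \<mu> (H t) x y = (\<Sum>i\<in>Basis. \<Sum>j\<in>Basis.
          (x \<bullet> \<mu> (adjoint (K t) i) (adjoint (K t) j)) * (y \<bullet> \<mu> (adjoint (K t) i) (adjoint (K t) j)))"
        using assms(1) by (intro bracket_square_gram) (auto simp: is_bracket_def)
      then show ?thesis by (simp add: Pmap_inner Km[OF that])
    qed
    have "2 * (Pmap (m t) (K t x) \<bullet> K t x) \<le> C / t * (K t x \<bullet> K t x)" for x
    proof -
      obtain p where p: "degree p \<le> d" "\<And>t. 0 \<le> t \<Longrightarrow> H t x x = poly p t"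
        using d[of H x x, OF bil] derP sq by auto
      have "0 \<le> H s x x" for s by (simp add: H_def)
      then have "0 \<le> poly p s \<and> poly p s \<le> poly p t" if "0 \<le> s" "s \<le> t" for s
        using nondecreasing_on_ray[OF derP[of _ x x] _ that] that p(2)[of s, symmetric] p(2)[of t, symmetric] t
        by (simp add: Pmap_nonneg)
      then have "poly (pderiv p) t \<le> C / t * poly p t" using C[OF p(1) t] by blast
      moreover have "poly (pderiv p) t = 2 * (Pmap (m t) (K t x) \<bullet> K t x)"
      proof (rule vector_derivative_unique_within)
        have "at t within {0..} = at t" using t by (intro at_within_interior) simp
        then show "at t within {0..} \<noteq> bot" by simp
        show "((\<lambda>s. H s x x) has_vector_derivative 2 * (Pmap (m t) (K t x) \<bullet> K t x)) (at t within {0..})"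
          using derP t by simp
        show "((\<lambda>s. H s x x) has_vector_derivative poly (pderiv p) t) (at t within {0..})"
          by (rule has_vector_derivative_transform[OF _ _ has_vector_derivative_at_within[OF
            poly_DERIV[of p t, unfolded has_real_derivative_iff_has_vector_derivative]]])
            (use t p(2) in simp_all)
      qed
      ultimately show ?thesis using p(2)[of t] t by (simp add: H_def)
    qed
    \<comment> \<open>The estimate holds on the range of \<open>K t\<close>, which is
      everything.\<close>
    then have bd: "2 * (Pmap (m t) z \<bullet> z) \<le> C / t * (z \<bullet> z)" for z
      using surjK[of t] t by (metis less_imp_le surjD)
    have "2 * bnorm2 (m t) = (\<Sum>b\<in>Basis. 2 * (Pmap (m t) b \<bullet> b))"
      by (simp add: bnorm2_eq_trace_Pmap sum_distrib_left)
    also have "\<dots> \<le> (\<Sum>b\<in>(Basis :: 'a set). C / t)"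
      using bd by (intro sum_mono) (metis inner_same_Basis mult.right_neutral)
    finally show "bnorm2 (m t) \<le> (real DIM('a) * C / 2) / t" using t by (simp add: field_simps)
  qed
qed

section \<open>Lower bound along the flow\<close>

text \<open>The sum is the trace of \<open>L P L^T\<close>, which equals half the sum of the squared
  norms of \<open>L (\<nu> a b)\<close>.\<close>

lemma sum_inner_Pmap_nonneg:
  fixes L :: "'a::euclidean_space \<Rightarrow> 'b::real_inner"
  assumes "linear L"
  shows "0 \<le> (\<Sum>i\<in>Basis. L i \<bullet> L (Pmap \<nu> i))"
proof -
  have "(\<Sum>i\<in>Basis. L i \<bullet> L (Pmap \<nu> i)) =
      (\<Sum>i\<in>Basis. \<Sum>a\<in>Basis. \<Sum>b\<in>Basis. ((i \<bullet> \<nu> a b) *\<^sub>R L i) \<bullet> L (\<nu> a b)) / 2"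
    by (simp add: Pmap_def linear_sum[OF assms] linear_scale[OF assms] inner_sum_right sum_divide_distrib)
  also have "(\<Sum>i\<in>Basis. \<Sum>a\<in>Basis. \<Sum>b\<in>Basis. ((i \<bullet> \<nu> a b) *\<^sub>R L i) \<bullet> L (\<nu> a b)) =
      (\<Sum>a\<in>Basis. \<Sum>b\<in>Basis. \<Sum>i\<in>Basis. ((i \<bullet> \<nu> a b) *\<^sub>R L i) \<bullet> L (\<nu> a b))"
    by (subst sum.swap, subst (2) sum.swap) (rule refl)
  also have "\<dots> = (\<Sum>a\<in>Basis. \<Sum>b\<in>Basis. L (\<nu> a b) \<bullet> L (\<nu> a b))"
    unfolding inner_sum_left[symmetric]
    by (simp add: linear_expand_Basis[OF assms, of "\<nu> _ _"] inner_commute)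
  also have "0 \<le> \<dots> / 2" by (simp add: sum_nonneg)
  finally show ?thesis .
qed

text \<open>The two subtracted terms of \<open>pi_act\<close> contribute nonnegative traces. The
  remaining one is controlled by \<open>P \<le> bnorm2 \<nu>\<close>, and the sum over ordered pairs
  of the squared norms is twice \<open>bnorm2 \<nu>\<close>.\<close>

lemma inner_pi_act_Pmap_le:
  assumes "bilinear \<nu>"
  shows "(\<Sum>i\<in>Basis. \<Sum>j\<in>Basis. \<nu> i j \<bullet> pi_act (Pmap \<nu>) \<nu> i j) \<le> 2 * (bnorm2 \<nu>)\<^sup>2"
proof -
  have Pmap_le: "x \<bullet> Pmap \<nu> x \<le> bnorm2 \<nu> * (norm x)\<^sup>2" for x
  proof -
    have "(x \<bullet> \<nu> i j) * (x \<bullet> \<nu> i j) \<le> (norm (\<nu> i j))\<^sup>2 * (norm x)\<^sup>2" for i j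
      using Cauchy_Schwarz_ineq[of x "\<nu> i j"] unfolding power2_norm_eq_inner
      by (simp add: power2_eq_square mult.commute)
    then have "(\<Sum>i\<in>Basis. \<Sum>j\<in>Basis. (x \<bullet> \<nu> i j) * (x \<bullet> \<nu> i j)) \<le>
        (\<Sum>i\<in>Basis. \<Sum>j\<in>Basis. (norm (\<nu> i j))\<^sup>2 * (norm x)\<^sup>2)"
      by (intro sum_mono)
    then show ?thesis
      by (simp add: inner_commute[of x "Pmap \<nu> x"] Pmap_inner bnorm2_def sum_distrib_right[symmetric])
  qed
  have "0 \<le> (\<Sum>j\<in>Basis. \<Sum>i\<in>Basis. \<nu> i j \<bullet> \<nu> (Pmap \<nu> i) j)"
    using assms by (intro sum_nonneg sum_inner_Pmap_nonneg[of "\<lambda>x. \<nu> x _"]) (simp add: bilinear_def)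
  then have 1: "0 \<le> (\<Sum>i\<in>Basis. \<Sum>j\<in>Basis. \<nu> i j \<bullet> \<nu> (Pmap \<nu> i) j)"
    by (subst sum.swap)
  have 2: "0 \<le> (\<Sum>i\<in>Basis. \<Sum>j\<in>Basis. \<nu> i j \<bullet> \<nu> i (Pmap \<nu> j))"
    using assms by (intro sum_nonneg sum_inner_Pmap_nonneg) (simp add: bilinear_def)
  have "(\<Sum>i\<in>Basis. \<Sum>j\<in>Basis. \<nu> i j \<bullet> pi_act (Pmap \<nu>) \<nu> i j) \<le>
      (\<Sum>i\<in>Basis. \<Sum>j\<in>Basis. \<nu> i j \<bullet> Pmap \<nu> (\<nu> i j))"
    using 1 2 by (simp add: pi_act_def inner_diff_right sum_subtractf)
  also have "\<dots> \<le> (\<Sum>i\<in>Basis. \<Sum>j\<in>Basis. bnorm2 \<nu> * (norm (\<nu> i j))\<^sup>2)"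
    by (intro sum_mono Pmap_le)
  also have "\<dots> = 2 * (bnorm2 \<nu>)\<^sup>2"
    unfolding sum_distrib_left[symmetric] by (simp add: bnorm2_def power2_eq_square[of "_ / _"])
  finally show ?thesis .
qed

text \<open>The derivative of \<open>1 / f\<close> is at most \<open>c\<close>. To divide by
  \<open>f\<close> its positivity is shown first: if \<open>f \<le> M\<close> on
  \<open>{0..T}\<close>, then \<open>f' \<ge> - c M f\<close>, so \<open>f s * exp (c M s)\<close>
  is nondecreasing.\<close>

lemma riccati_lower_bound:
  fixes f :: "real \<Rightarrow> real"
  assumes der: "\<And>t. 0 \<le> t \<Longrightarrow> (f has_vector_derivative f' t) (at t within {0..})"
    and f': "\<And>t. 0 \<le> t \<Longrightarrow> - c * (f t)\<^sup>2 \<le> f' t"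
    and nonneg: "\<And>t. 0 \<le> t \<Longrightarrow> 0 \<le> f t" and "0 < f 0" "0 \<le> c" "0 \<le> t"
  shows "0 < f t" "inverse (f t) \<le> c * t + inverse (f 0)"
proof -
  have pos: "0 < f T" if T: "0 \<le> T" for T
  proof -
    have "continuous_on {0..T} f"
      using continuous_on_subset[OF continuous_on_has_vector_derivative[of "{0..}" f f']] der by fastforce
    then obtain M where M: "\<And>s. s \<in> {0..T} \<Longrightarrow> f s \<le> M"
      using continuous_attains_sup[of "{0..T}" f] T by force
    have "f 0 * exp (c * M * 0) \<le> f T * exp (c * M * T)"
    proof (rule nondecreasing_on_ray[OF _ _ _ T])
      show "((\<lambda>s. f s * exp (c * M * s)) has_vector_derivative (f' s + c * M * f s) * exp (c * M * s)) (at s within {0..})"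
        if "0 \<le> s" for s
        using der[OF that] unfolding has_real_derivative_iff_has_vector_derivative[symmetric]
        by (auto intro!: derivative_eq_intros simp: algebra_simps)
      show "0 \<le> (f' s + c * M * f s) * exp (c * M * s)" if "0 \<le> s" "s \<le> T" for s
      proof -
        have "c * f s * f s \<le> c * f s * M"
          using M[of s] nonneg[of s] that \<open>0 \<le> c\<close> by (intro mult_left_mono) auto
        then have "0 \<le> f' s + c * M * f s"
          using f'[OF that(1)] by (simp add: power2_eq_square algebra_simps)
        then show ?thesis by simp
      qed
    qed simp
    then have "0 < f T * exp (c * M * T)" using \<open>0 < f 0\<close> by simp
    then show ?thesis by (simp add: zero_less_mult_iff)
  qed
  show "0 < f t" using pos \<open>0 \<le> t\<close> by simp
  have "c * 0 - inverse (f 0) \<le> c * t - inverse (f t)"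
  proof (rule nondecreasing_on_ray[OF _ _ _ \<open>0 \<le> t\<close>])
    show "((\<lambda>s. c * s - inverse (f s)) has_vector_derivative c + f' s / (f s)\<^sup>2) (at s within {0..})"
      if "0 \<le> s" for s
      using der[OF that] pos[OF that] unfolding has_real_derivative_iff_has_vector_derivative[symmetric]
      by (auto intro!: derivative_eq_intros simp: field_simps power2_eq_square)
    show "0 \<le> c + f' s / (f s)\<^sup>2" if "0 \<le> s" for s
      using f'[OF that] pos[OF that] by (simp add: field_simps)
  qed simp
  then show "inverse (f t) \<le> c * t + inverse (f 0)" by simp
qed

lemma bnorm2_nonneg: "0 \<le> bnorm2 \<nu>"
  by (simp add: bnorm2_def sum_nonneg)

lemma bnorm2_pos:
  assumes "bilinear \<nu>" "\<nu> \<noteq> (\<lambda>x y. 0)"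
  shows "0 < bnorm2 \<nu>"
proof (rule ccontr)
  assume "\<not> 0 < bnorm2 \<nu>"
  then have "bnorm2 \<nu> = 0" using bnorm2_nonneg[of \<nu>] by simp
  then have "\<forall>i\<in>Basis. \<forall>j\<in>Basis. \<nu> i j = 0"
    by (simp add: bnorm2_def sum_nonneg_eq_0_iff sum_nonneg)
  then have "\<nu> x y = 0" for x y
    by (subst bilinear_expand_Basis[OF assms(1)]) (auto intro: sum.neutral)
  then show False using assms(2) by blast
qed

lemma flow_lower_bound:
  assumes sol: "bracket_flow_solution \<mu> m" and "\<mu> \<noteq> (\<lambda>x y. 0)" "0 \<le> t"
  shows "0 < bnorm2 (m t)" "inverse (bnorm2 (m t)) \<le> 2 * t + inverse (bnorm2 \<mu>)"
proof -
  \<comment> \<open>The 2 from differentiating a square cancels the 1/2 in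
    \<open>bnorm2\<close>.\<close>
  let ?f' = "\<lambda>t. - (\<Sum>i\<in>Basis. \<Sum>j\<in>Basis. m t i j \<bullet> pi_act (Pmap (m t)) (m t) i j)"
  have der: "((\<lambda>t. bnorm2 (m t)) has_vector_derivative ?f' t) (at t within {0..})" if "0 \<le> t" for t
  proof -
    have "((\<lambda>s. (\<Sum>i\<in>Basis. \<Sum>j\<in>Basis. m s i j \<bullet> m s i j) / 2) has_vector_derivative
        (\<Sum>i\<in>Basis. \<Sum>j\<in>Basis. m t i j \<bullet> (- pi_act (Pmap (m t)) (m t) i j)
          + (- pi_act (Pmap (m t)) (m t) i j) \<bullet> m t i j) / 2) (at t within {0..})"
      by (intro has_vector_derivative_divide has_vector_derivative_sum has_vector_derivative_inner
          flow_derivative[OF sol that])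
    moreover have "(\<Sum>i\<in>Basis. \<Sum>j\<in>Basis. m t i j \<bullet> (- pi_act (Pmap (m t)) (m t) i j)
          + (- pi_act (Pmap (m t)) (m t) i j) \<bullet> m t i j) / 2 = ?f' t"
      by (simp add: inner_commute[of "pi_act _ _ _ _"] sum_negf sum_distrib_left[symmetric])
    ultimately show ?thesis by (simp add: bnorm2_def power2_norm_eq_inner)
  qed
  have le: "- 2 * (bnorm2 (m t))\<^sup>2 \<le> ?f' t" if "0 \<le> t" for t
    using inner_pi_act_Pmap_le[OF flow_bilinear[OF sol that]] by simp
  have "0 < bnorm2 (m 0)"
    using bnorm2_pos[OF flow_bilinear[OF sol, of 0]] assms(2) flow_initial[OF sol] by simp
  from riccati_lower_bound[OF der le bnorm2_nonneg this _ \<open>0 \<le> t\<close>]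
  show "0 < bnorm2 (m t)" "inverse (bnorm2 (m t)) \<le> 2 * t + inverse (bnorm2 \<mu>)"
    by (simp_all add: flow_initial[OF sol])
qed

lemma flow_estimates:
  fixes \<mu> :: "'a::euclidean_space bracket"
  assumes "is_bracket \<mu>" "nilpotent_bracket \<mu>" "\<mu> \<noteq> (\<lambda>x y. 0)"
  shows "\<exists>C>0. \<forall>m. bracket_flow_solution \<mu> m \<longrightarrow>
            (\<forall>t>0. inverse (C * t + inverse (bnorm2 \<mu>)) \<le> bnorm2 (m t)
                    \<and> bnorm2 (m t) \<le> C / t)
            \<and> ((\<lambda>t. bnorm2 (m t)) \<longlongrightarrow> 0) at_top"
proof -
  obtain C where C0: "0 \<le> C"
    and C: "\<And>m t. bracket_flow_solution \<mu> m \<Longrightarrow> 0 < t \<Longrightarrow> bnorm2 (m t) \<le> C / t"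
    using flow_upper_bound[OF assms(1,2)] by blast
  show ?thesis
  \<comment> \<open>One constant for both sides: the upper bound needs at least \<open>C\<close>,
    the lower bound at least 2.\<close>
  proof (intro exI[of _ "C + 2"] conjI allI impI)
    show "0 < C + 2" using C0 by simp
    fix m assume sol: "bracket_flow_solution \<mu> m"
    show "bnorm2 (m t) \<le> (C + 2) / t" if "0 < t" for t
      using C[OF sol that] that by (simp add: field_simps)
    show "inverse ((C + 2) * t + inverse (bnorm2 \<mu>)) \<le> bnorm2 (m t)" if "0 < t" for t
    proof -
      note low = flow_lower_bound[OF sol assms(3) less_imp_le[OF that]]
      have "inverse (bnorm2 (m t)) \<le> (C + 2) * t + inverse (bnorm2 \<mu>)"
        using low(2) mult_nonneg_nonneg[OF C0 less_imp_le[OF that]] by (simp add: algebra_simps)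
      from le_imp_inverse_le[OF this] low(1) show ?thesis by simp
    qed
    show "((\<lambda>t. bnorm2 (m t)) \<longlongrightarrow> 0) at_top"
    proof (rule tendsto_sandwich[of "\<lambda>_. 0"])
      show "\<forall>\<^sub>F t in at_top. bnorm2 (m t) \<le> C / t"
        using eventually_gt_at_top[of 0] by eventually_elim (rule C[OF sol])
      show "((\<lambda>t. C / t) \<longlongrightarrow> 0) at_top"
        by (intro tendsto_divide_0[OF tendsto_const] filterlim_at_top_imp_at_infinity filterlim_ident)
    qed (simp_all add: bnorm2_nonneg)
  qed
qed

section \<open>Existence of the flow\<close>

lemma bilinear_bracket_square: "bilinear (bracket_square \<mu> F)"
  unfolding bilinear_def bracket_square_def
  by (auto intro!: linearI simp: inner_add_left sum.distrib[symmetric] sum_distrib_left algebra_simps)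

lemma bracket_square_sym:
  assumes "\<And>x y. F x y = F y x"
  shows "bracket_square \<mu> F x y = bracket_square \<mu> F y x"
  unfolding bracket_square_def
  by (subst sum.swap, intro sum.cong refl)
    (simp add: assms mult_ac)

lemma continuous_on_bracket_square:
  assumes "\<And>x y. continuous_on S (\<lambda>t. H t x y)"
  shows "continuous_on S (\<lambda>t. bracket_square \<mu> (H t) x y)"
  unfolding bracket_square_def by (intro continuous_intros assms)

text \<open>Picard iteration for the equation of the inverse metric, started at the inner product
  because \<open>h\<close> is the identity at time 0.\<close>

fun picard :: "'a::euclidean_space bracket \<Rightarrow> nat \<Rightarrow> real \<Rightarrow> 'a \<Rightarrow> 'a \<Rightarrow> real" where
  "picard \<mu> 0 t x y = x \<bullet> y"
| "picard \<mu> (Suc n) t x y = x \<bullet> y + integral {0..t} (\<lambda>s. bracket_square \<mu> (picard \<mu> n s) x y)"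

lemma picard_continuous: "continuous_on {0..} (\<lambda>t. picard \<mu> n t x y)"
  and picard_derivative: "0 \<le> t \<Longrightarrow>
    ((\<lambda>s. picard \<mu> (Suc n) s x y) has_vector_derivative bracket_square \<mu> (picard \<mu> n t) x y) (at t within {0..})"
proof -
  have der: "((\<lambda>s. picard \<mu> (Suc n) s x y) has_vector_derivative bracket_square \<mu> (picard \<mu> n t) x y) (at t within {0..})"
    if "\<And>x y. continuous_on {0..} (\<lambda>t. picard \<mu> n t x y)" "0 \<le> t" for n x y t
    using has_vector_derivative_add[OF has_vector_derivative_const
        integral_has_vector_derivative_atLeast[OF continuous_on_bracket_square[OF that(1)] that(2)]]
    by simp
  have cont: "continuous_on {0..} (\<lambda>t. picard \<mu> n t x y)" for n x y
  proof (induction n arbitrary: x y)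
    case (Suc n)
    show ?case
      by (rule continuous_on_has_vector_derivative[OF der[OF Suc]]) simp
  qed simp
  show "continuous_on {0..} (\<lambda>t. picard \<mu> n t x y)" by (rule cont)
  show "0 \<le> t \<Longrightarrow>
    ((\<lambda>s. picard \<mu> (Suc n) s x y) has_vector_derivative bracket_square \<mu> (picard \<mu> n t) x y) (at t within {0..})"
    by (rule der[OF cont])
qed

text \<open>For negative \<open>t\<close> the interval is empty and the integral 0, so the iterates
  are the inner product there and the algebraic facts below hold for every real
  \<open>t\<close>.\<close>

lemma bracket_square_picard_integrable:
  "(\<lambda>s. bracket_square \<mu> (picard \<mu> n s) x y) integrable_on {0..t}"
  by (rule integrable_continuous_real continuous_on_subset[OF continuous_on_bracket_square[OF picard_continuous]])+
    auto

lemma bilinear_picard: "bilinear (picard \<mu> n t)"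
proof (cases n)
  case 0
  then show ?thesis
    by (auto simp: bilinear_def inner_add_left inner_add_right intro!: linearI)
next
  case (Suc k)
  note bs = bilinear_bracket_square[of \<mu>] and int = bracket_square_picard_integrable[of \<mu> k]
  show ?thesis
    unfolding Suc bilinear_def
    by (auto intro!: linearI simp: inner_add_left inner_add_right bilinear_ladd[OF bs] bilinear_radd[OF bs]
        bilinear_lmul[OF bs] bilinear_rmul[OF bs] integral_add[OF int int] algebra_simps)
qed

lemma picard_sym: "picard \<mu> n t x y = picard \<mu> n t y x"
proof (induction n arbitrary: t x y)
  case (Suc n)
  show ?case using bracket_square_sym[of "picard \<mu> n _", OF Suc] by (simp add: inner_commute)
qed (simp add: inner_commute)

text \<open>Inductively the iterates are positive semidefinite, so the integrand is nonnegative on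
  the diagonal. This bound later makes the limit invertible, with an inverse of norm at most
  1.\<close>

lemma picard_ge_inner:
  assumes "bilinear \<mu>"
  shows "x \<bullet> x \<le> picard \<mu> n t x x"
proof (induction n arbitrary: t x)
  case (Suc n)
  have "0 \<le> bracket_square \<mu> (picard \<mu> n s) x x" for s
    using Suc by (intro bracket_square_nonneg assms bilinear_picard picard_sym) (meson inner_ge_zero order_trans)
  then show ?case by (simp add: integral_nonneg[OF bracket_square_picard_integrable])
qed simp

text \<open>The integrand at \<open>x\<close> and \<open>y\<close> sees the preceding iterate only
  on \<open>E\<close>, inside the annihilator one level lower. So each level of the lower central
  series costs one iteration, starting from the zero annihilator at level 0.\<close>

lemma picard_stationary:
  assumes "is_bracket \<mu>" "x \<in> (lcs \<mu> k)\<^sup>\<bottom>" "y \<in> (lcs \<mu> k)\<^sup>\<bottom>" "k \<le> n"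
  shows "picard \<mu> (Suc n) t x y = picard \<mu> n t x y"
  using assms(2-)
proof (induction k arbitrary: n t x y)
  case 0
  then show ?case by (simp add: bilinear_lzero[OF bilinear_picard] del: picard.simps)
next
  case (Suc k)
  obtain l where n: "n = Suc l" "k \<le> l" using Suc.prems(3) by (cases n) auto
  obtain E where E: "finite E" "E \<subseteq> (lcs \<mu> k)\<^sup>\<bottom>"
    "\<And>x u v. x \<in> (lcs \<mu> (Suc k))\<^sup>\<bottom> \<Longrightarrow>
      x \<bullet> \<mu> u v = (\<Sum>e\<in>E \<times> E. (x \<bullet> \<mu> (fst e) (snd e)) * ((fst e \<bullet> u) * (snd e \<bullet> v)))"
    using lcs_adapted_basis[OF assms(1), of k] by blast
  note restrict = bracket_square_restrict[OF bilinear_picard E(3)[OF Suc.prems(1)] E(3)[OF Suc.prems(2)]]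
  have "bracket_square \<mu> (picard \<mu> (Suc l) s) x y = bracket_square \<mu> (picard \<mu> l s) x y" for s
  proof -
    have "picard \<mu> (Suc l) s a c = picard \<mu> l s a c" if "a \<in> E" "c \<in> E" for a c
      using that E(2) n(2) by (intro Suc.IH) auto
    then show ?thesis
      unfolding restrict by (intro sum.cong refl) (auto simp del: picard.simps)
  qed
  then show ?case unfolding n(1) picard.simps(2)[of _ "Suc l"] picard.simps(2)[of _ l] by simp
qed

text \<open>Where the lower central series reaches zero, the iterate \<open>picard \<mu> k\<close>
  equals its successor everywhere. It is a fixed point of the Picard map and hence a solution on the
  whole ray.\<close>

lemma inverse_metric_flow_exists:
  fixes \<mu> :: "'a::euclidean_space bracket"
  assumes "is_bracket \<mu>" "nilpotent_bracket \<mu>"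
  obtains H where "\<And>t. bilinear (H t)" "\<And>t x y. H t x y = H t y x" "\<And>t x. x \<bullet> x \<le> H t x x"
    "\<And>x y. H 0 x y = x \<bullet> y" "\<And>x y. continuous_on {0..} (\<lambda>t. H t x y)"
    "\<And>t x y. 0 \<le> t \<Longrightarrow> ((\<lambda>s. H s x y) has_vector_derivative bracket_square \<mu> (H t) x y) (at t within {0..})"
proof -
  obtain k where k: "lcs \<mu> k = {0}" using assms(2) by (auto simp: nilpotent_bracket_def)
  have stat: "picard \<mu> (Suc k) t x y = picard \<mu> k t x y" for t x y
    by (rule picard_stationary[OF assms(1), of _ k]) (simp_all add: k)
  show ?thesis
  proof (rule that[of "picard \<mu> k"])
    show "picard \<mu> k 0 x y = x \<bullet> y" for x y by (cases k) auto
    show "x \<bullet> x \<le> picard \<mu> k t x x" for t x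
      using assms(1) by (intro picard_ge_inner) (simp add: is_bracket_def)
    show "((\<lambda>s. picard \<mu> k s x y) has_vector_derivative bracket_square \<mu> (picard \<mu> k t) x y) (at t within {0..})"
      if "0 \<le> t" for t x y
      using picard_derivative[OF that, of \<mu> k x y] unfolding stat .
  qed (rule bilinear_picard picard_sym picard_continuous)+
qed

section \<open>Recovering the bracket flow from the inverse metric\<close>

definition form_map :: "('a \<Rightarrow> 'a \<Rightarrow> real) \<Rightarrow> 'a \<Rightarrow> 'a::euclidean_space" where
  "form_map F x = (\<Sum>b\<in>Basis. F x b *\<^sub>R b)"

lemma form_map_inner: "bilinear F \<Longrightarrow> form_map F x \<bullet> y = F x y"
  using linear_expand_Basis[of "F x" y]
  by (simp add: form_map_def inner_sum_left bilinear_def inner_commute[of y] mult.commute)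

lemma linear_form_map: "bilinear F \<Longrightarrow> linear (form_map F)"
  by (rule linearI)
    (simp_all add: form_map_def bilinear_ladd bilinear_lmul scaleR_add_left sum.distrib scaleR_sum_right)

text \<open>A form above the inner product is represented by a map that does not decrease norms. It
  is therefore injective, and its inverse does not increase norms.\<close>

lemma form_map_inverse_exists:
  assumes bil: "bilinear F" and ge: "\<And>x. x \<bullet> x \<le> F x x"
  obtains G where "linear G" "\<And>x. G (form_map F x) = x" "\<And>x. form_map F (G x) = x" "\<And>x. norm (G x) \<le> norm x"
proof -
  have le: "norm x \<le> norm (form_map F x)" for x
  proof (cases "x = 0")
    case False
    have "norm x * norm x \<le> form_map F x \<bullet> x"
      using ge[of x] by (simp add: form_map_inner[OF bil] dot_square_norm power2_eq_square[symmetric])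
    also have "\<dots> \<le> norm (form_map F x) * norm x" by (rule norm_cauchy_schwarz)
    finally show ?thesis using False by simp
  qed simp
  have "inj (form_map F)"
    unfolding linear_injective_0[OF linear_form_map[OF bil]] by (metis le norm_le_zero_iff norm_zero)
  then obtain G where "linear G" "\<And>x. G (form_map F x) = x" "\<And>x. form_map F (G x) = x"
    using linear_injective_isomorphism[OF linear_form_map[OF bil]] by blast
  then show ?thesis using le that by metis
qed

text \<open>Once \<open>H\<close> is known, the transpose \<open>g\<close> of \<open>h\<close>
  satisfies a linear equation with coefficients built from \<open>H\<close>. Then
  \<open>k = H g\<close> is the inverse of \<open>h\<close>, and \<open>m\<close> is
  \<open>\<mu>\<close> transported by \<open>h\<close>.\<close>

lemma bracket_flow_solution_exists:
  fixes \<mu> :: "'a::euclidean_space bracket"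
  assumes "is_bracket \<mu>" "nilpotent_bracket \<mu>"
  obtains m where "bracket_flow_solution \<mu> m"
proof -
  have bil\<mu>: "bilinear \<mu>" and skew: "\<And>x y. \<mu> x y = - \<mu> y x"
    using assms(1) unfolding is_bracket_def by blast+
  obtain H where bil: "\<And>t. bilinear (H t)" and sym: "\<And>t x y. H t x y = H t y x"
    and ge: "\<And>t x. x \<bullet> x \<le> H t x x" and H0: "\<And>x y. H 0 x y = x \<bullet> y"
    and cont: "\<And>x y. continuous_on {0..} (\<lambda>t. H t x y)"
    and der: "\<And>t x y. 0 \<le> t \<Longrightarrow>
      ((\<lambda>s. H s x y) has_vector_derivative bracket_square \<mu> (H t) x y) (at t within {0..})"
    using inverse_metric_flow_exists[OF assms] by blast
  define B where "B t = bracket_square \<mu> (H t)" for t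
  define M where "M t = form_map (H t)" for t
  define D where "D t = form_map (B t)" for t
  have bilB: "bilinear (B t)" for t unfolding B_def by (rule bilinear_bracket_square)
  have linM: "linear (M t)" and linD: "linear (D t)" for t
    unfolding M_def D_def by (rule linear_form_map bil bilB)+
  have M: "M t x \<bullet> y = H t x y" and D: "D t x \<bullet> y = B t x y" for t x y
    unfolding M_def D_def by (rule form_map_inner bil bilB)+
  have symB: "B t x y = B t y x" for t x y unfolding B_def by (rule bracket_square_sym) (rule sym)
  have "\<exists>G. linear G \<and> (\<forall>x. G (M t x) = x) \<and> (\<forall>x. M t (G x) = x) \<and> (\<forall>x. norm (G x) \<le> norm x)" for t
    using form_map_inverse_exists[OF bil ge, of t] unfolding M_def by metis
  then obtain G where linG: "\<And>t. linear (G t)" and GM: "\<And>t x. G t (M t x) = x"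
    and MG: "\<And>t x. M t (G t x) = x" and normG: "\<And>t x. norm (G t x) \<le> norm x"
    by metis
  have contM: "continuous_on {0..} (\<lambda>t. M t x)" and contD: "continuous_on {0..} (\<lambda>t. D t x)" for x
    unfolding M_def D_def B_def form_map_def
    by (intro continuous_intros cont continuous_on_bracket_square)+
  \<comment> \<open>Resolvent identity: \<open>G s - G t = G s (M t - M s) G t\<close>, and
    \<open>G s\<close> does not increase norms.\<close>
  have contG: "continuous_on {0..} (\<lambda>t. G t x)" for x
    unfolding continuous_on_def
  proof
    fix t :: real assume t: "t \<in> {0..}"
    have lim: "((\<lambda>s. M s (G t x)) \<longlongrightarrow> M t (G t x)) (at t within {0..})"
      using contM t by (simp add: continuous_on_def)
    have "G s x - G t x = G s (M t (G t x) - M s (G t x))" for s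
      by (simp add: linear_diff[OF linG] MG GM)
    then have "dist (G s x) (G t x) \<le> dist (M s (G t x)) (M t (G t x))" for s
      using normG[of s "M t (G t x) - M s (G t x)"] by (simp add: dist_norm norm_minus_commute)
    then show "((\<lambda>s. G s x) \<longlongrightarrow> G t x) (at t within {0..})"
      by (intro metric_tendsto_imp_tendsto[OF lim] always_eventually) simp
  qed
  \<comment> \<open>The wanted equation is \<open>g' = - g P\<close>. Substituting
    \<open>2 P = h H' g\<close> and \<open>g h = G\<close>, the inverse of \<open>H\<close>, leaves
    \<open>g' = - G H' g / 2\<close>.\<close>
  define A where "A t x = - (1/2) *\<^sub>R G t (D t x)" for t x
  have linA: "linear (A t)" for t
    unfolding A_def using linear_compose[OF linD linG]
    by (intro linear_compose_scale_right) (simp add: o_def)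
  have contA: "continuous_on {0..} (\<lambda>t. A t x)" for x
    unfolding A_def
    by (intro continuous_on_scaleR continuous_on_const continuous_on_linear_family[OF linG contG contD])
  obtain g where ling: "\<And>t. linear (g t)" and g0: "\<And>x. g 0 x = x"
    and g: "\<And>t x. 0 \<le> t \<Longrightarrow> ((\<lambda>s. g s x) has_vector_derivative A t (g t x)) (at t within {0..})"
    using linear_ode_flow_exists[OF linA contA] by blast
  have HA: "H t (A t x) y = - B t x y / 2" for t x y
    by (simp add: A_def M[symmetric] linear_neg[OF linM] linear_scale[OF linM] MG D)
  \<comment> \<open>Each of the two terms with \<open>A\<close> contributes \<open>- B / 2\<close>,
    cancelling the derivative \<open>B\<close> of \<open>H\<close>. In matrix terms the conserved
    identity is \<open>g^T H g = 1\<close>, that is \<open>h k = 1\<close>.\<close>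
  have Hg: "H t (g t x) (g t y) = x \<bullet> y" if "0 \<le> t" for t x y
  proof -
    have "((\<lambda>s. H s (g s x) (g s y)) has_vector_derivative 0) (at s within {0..})" if "0 \<le> s" for s
    proof -
      have "((\<lambda>s. H s (g s x) (g s y)) has_vector_derivative B s (g s x) (g s y) +
          H s (A s (g s x)) (g s y) + H s (g s x) (A s (g s y))) (at s within {0..})"
        using that der g
        by (intro bilinear_family_has_vector_derivative[OF bil _ bilB]) (auto simp: B_def)
      then show ?thesis by (simp add: sym[of s "g s x"] HA symB[of s "g s y"])
    qed
    from eq_initial_value[OF this that] show ?thesis by (simp add: g0 H0)
  qed
  define k where "k t x = M t (g t x)" for t x
  define h where "h t = adjoint (g t)" for t
  have link: "linear (k t)" for t
    using linear_compose[OF ling linM, of t t] by (simp add: k_def[abs_def] o_def)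
  have linh: "linear (h t)" for t unfolding h_def by (rule adjoint_linear[OF ling])
  have h: "h t x \<bullet> y = x \<bullet> g t y" for t x y
    unfolding h_def by (rule adjoint_clauses(2)[OF ling])
  have kh: "k t (h t x) = x" if "0 \<le> t" for t x
  proof -
    have "h t (k t x) = x" for x
      by (rule euclidean_eqI) (simp add: h k_def M Hg[OF that])
    then have "h t \<circ> k t = id" by auto
    then have "k t \<circ> h t = id" using linear_inverse_left[OF linh link] by blast
    then show ?thesis by (simp add: fun_eq_iff)
  qed
  have gh: "g t (h t x) = G t x" if "0 \<le> t" for t x
    using GM[of t "g t (h t x)"] kh[OF that, of x] by (simp add: k_def)
  define m where "m t x y = h t (\<mu> (k t x) (k t y))" for t x y
  have m: "m t x y \<bullet> z = \<mu> (k t x) (k t y) \<bullet> g t z" for t x y z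
    by (simp add: m_def h)
  \<comment> \<open>As \<open>k\<close> inverts \<open>h\<close>, the vectors \<open>k t i\<close>
    are Gram vectors of \<open>H t\<close>. This confirms the formula for \<open>P\<close> from
    which \<open>A\<close> was read off.\<close>
  have P: "Pmap (m t) x = (1/2) *\<^sub>R h t (D t (g t x))" if "0 \<le> t" for t x
  proof (rule euclidean_eqI)
    fix z :: 'a
    have "H t a c = (\<Sum>i\<in>Basis. (a \<bullet> k t i) * (c \<bullet> k t i))" for a c
    proof -
      have ak: "a \<bullet> k t i = h t (M t a) \<bullet> i" for a i
        by (simp add: k_def h M inner_commute[of a] sym[of t a])
      have "(\<Sum>i\<in>Basis. (a \<bullet> k t i) * (c \<bullet> k t i)) = h t (M t a) \<bullet> h t (M t c)"
        unfolding ak by (rule euclidean_inner[symmetric])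
      then show ?thesis by (simp add: h gh[OF that] GM M)
    qed
    then have "B t (g t x) (g t z) = (\<Sum>i\<in>Basis. \<Sum>j\<in>Basis.
        (g t x \<bullet> \<mu> (k t i) (k t j)) * (g t z \<bullet> \<mu> (k t i) (k t j)))"
      unfolding B_def by (rule bracket_square_gram[OF bil\<mu>])
    then show "Pmap (m t) x \<bullet> z = (1/2) *\<^sub>R h t (D t (g t x)) \<bullet> z"
      by (simp add: Pmap_inner h D inner_commute[of _ "m t _ _"] m inner_commute[of _ "\<mu> _ _"])
  qed
  have g': "((\<lambda>s. g s x) has_vector_derivative - g t (Pmap (m t) x)) (at t within {0..})" if "0 \<le> t" for t x
    using g[OF that, of x] by (simp add: P[OF that] linear_scale[OF ling] gh[OF that] A_def)
  \<comment> \<open>In \<open>k = H g\<close> the derivative of \<open>H\<close> gives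
    \<open>B\<close> and that of \<open>g\<close> takes away half of it; the remaining
    \<open>B / 2\<close> is \<open>k P\<close>.\<close>
  have k': "((\<lambda>s. k s x) has_vector_derivative k t (Pmap (m t) x)) (at t within {0..})" if "0 \<le> t" for t x
  proof -
    have "((\<lambda>s. H s (g s x) b) has_vector_derivative B t (g t x) b / 2) (at t within {0..})" for b
    proof -
      have "((\<lambda>s. H s (g s x) b) has_vector_derivative B t (g t x) b + H t (A t (g t x)) b + H t (g t x) 0)
          (at t within {0..})"
        using that der g
        by (intro bilinear_family_has_vector_derivative[OF bil _ bilB]) (auto simp: B_def)
      then show ?thesis by (simp add: HA bilinear_rzero[OF bil])
    qed
    then have "((\<lambda>s. k s x) has_vector_derivative (\<Sum>b\<in>Basis. (B t (g t x) b / 2) *\<^sub>R b)) (at t within {0..})"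
      unfolding k_def M_def form_map_def
      by (intro has_vector_derivative_sum bounded_linear.has_vector_derivative[OF bounded_linear_scaleR_left])
    moreover have "(\<Sum>b\<in>Basis. (B t (g t x) b / 2) *\<^sub>R b) = k t (Pmap (m t) x)"
      by (simp add: P[OF that] linear_scale[OF link] kh[OF that] D_def form_map_def scaleR_sum_right)
    ultimately show ?thesis by simp
  qed
  have "bracket_flow_solution \<mu> m"
    unfolding bracket_flow_solution_def
  proof (intro conjI allI impI)
    have "m 0 x y \<bullet> z = \<mu> x y \<bullet> z" for x y z
    proof -
      have "k 0 x = x" for x
        by (rule euclidean_eqI) (simp add: k_def M H0 g0)
      then show ?thesis by (simp add: m g0)
    qed
    then show "m 0 = \<mu>" by (intro ext) (rule euclidean_eqI, simp)
    fix t :: real assume t: "0 \<le> t"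
    show "is_bracket (m t)"
      unfolding is_bracket_def
    proof (intro conjI allI)
      show "bilinear (m t)"
        unfolding bilinear_def m_def
        by (auto intro!: linearI simp: linear_add[OF link] linear_scale[OF link] linear_add[OF linh]
            linear_scale[OF linh] bilinear_ladd[OF bil\<mu>] bilinear_radd[OF bil\<mu>]
            bilinear_lmul[OF bil\<mu>] bilinear_rmul[OF bil\<mu>])
      show "m t x y = - m t y x" for x y
        unfolding m_def skew[of "k t x"] by (rule linear_neg[OF linh])
    qed
    fix x y
    have bb: "bounded_bilinear \<mu>" using bil\<mu> by (simp add: bilinear_conv_bounded_bilinear)
    \<comment> \<open>Testing against \<open>b\<close> moves \<open>h\<close> over to
      \<open>g\<close>, so the derivatives of \<open>k\<close> and \<open>g\<close> determine that
      of \<open>m\<close>.\<close>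
    have "((\<lambda>s. \<mu> (k s x) (k s y) \<bullet> g s b) has_vector_derivative
        - pi_act (Pmap (m t)) (m t) x y \<bullet> b) (at t within {0..})" for b
    proof -
      have "((\<lambda>s. \<mu> (k s x) (k s y) \<bullet> g s b) has_vector_derivative
          \<mu> (k t x) (k t y) \<bullet> (- g t (Pmap (m t) b)) +
          (\<mu> (k t x) (k t (Pmap (m t) y)) + \<mu> (k t (Pmap (m t) x)) (k t y)) \<bullet> g t b) (at t within {0..})"
        by (intro has_vector_derivative_inner bounded_bilinear.has_vector_derivative[OF bb] k'[OF t] g'[OF t])
      moreover have "\<mu> (k t x) (k t y) \<bullet> (- g t (Pmap (m t) b)) +
          (\<mu> (k t x) (k t (Pmap (m t) y)) + \<mu> (k t (Pmap (m t) x)) (k t y)) \<bullet> g t b =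
          - pi_act (Pmap (m t)) (m t) x y \<bullet> b"
        by (simp add: pi_act_def inner_diff_left inner_add_left m Pmap_symmetric)
      ultimately show ?thesis by simp
    qed
    then have "((\<lambda>s. \<Sum>b\<in>Basis. (m s x y \<bullet> b) *\<^sub>R b) has_vector_derivative
        (\<Sum>b\<in>Basis. (- pi_act (Pmap (m t)) (m t) x y \<bullet> b) *\<^sub>R b)) (at t within {0..})"
      unfolding m[symmetric]
      by (intro has_vector_derivative_sum bounded_linear.has_vector_derivative[OF bounded_linear_scaleR_left])
    then show "((\<lambda>s. m s x y) has_vector_derivative - pi_act (Pmap (m t)) (m t) x y) (at t within {0..})"
      unfolding euclidean_representation .
  qed
  then show ?thesis by (rule that)
qed

theorem theorem3p10:
  fixes J :: "'a::euclidean_space \<Rightarrow> 'a" and \<mu> :: "'a bracket"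
  assumes "complex_structure J"
    and "\<forall>x y. J x \<bullet> J y = x \<bullet> y"
    and "\<mu> \<in> complex_lie_brackets J"
    and "\<mu> \<noteq> (\<lambda>x y. 0)"
    and "nilpotent_bracket \<mu>"
  shows "(\<exists>m. bracket_flow_solution \<mu> m) \<and>
         (\<exists>C>0. \<forall>m. bracket_flow_solution \<mu> m \<longrightarrow>
            (\<forall>t>0. inverse (C * t + inverse (bnorm2 \<mu>)) \<le> bnorm2 (m t)
                    \<and> bnorm2 (m t) \<le> C / t)
            \<and> ((\<lambda>t. bnorm2 (m t)) \<longlongrightarrow> 0) at_top)"
proof
  have br: "is_bracket \<mu>" using assms(3) by (simp add: complex_lie_brackets_def)
  show "\<exists>m. bracket_flow_solution \<mu> m"
    using bracket_flow_solution_exists[OF br assms(5)] by blast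
  show "\<exists>C>0. \<forall>m. bracket_flow_solution \<mu> m \<longrightarrow>
            (\<forall>t>0. inverse (C * t + inverse (bnorm2 \<mu>)) \<le> bnorm2 (m t)
                    \<and> bnorm2 (m t) \<le> C / t)
            \<and> ((\<lambda>t. bnorm2 (m t)) \<longlongrightarrow> 0) at_top"
    by (rule flow_estimates[OF br assms(5,4)])
qed

end
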